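(* Let $\widetilde\nabla^t$ and $\widetilde{\nabla}'^t$ be two formal curves of translation invariant flat symplectic connections of Ricci type on $(\mathbb{R}^{2n},\Omega)$ with $\widetilde\nabla^0=\widetilde{\nabla}'^0$ the trivial connection. Then there exists a formal curve of symplectomorphisms $\widetilde\psi_t$ of $(\mathbb{R}^{2n},\Omega)$ such that $\widetilde\psi_t\cdot\widetilde\nabla^t=\widetilde{\nabla}'^t$.
   Context: $(\mathbb{R}^{2n},\Omega)$ is a symplectic vector space, $\Omega$ being viewed as a translation invariant symplectic form. The trivial connection is the standard flat connection, for which constant vector fields are parallel. A symplectic connection on a symplectic manifold $(M,\omega)$ is a torsion-free linear connection $\nabla$ with $\nabla\omega=0$. Formal curve of symplectic connections on $(M,\omega)$: a formal power series $\nabla^t=\nabla+\sum_{k\ge1}t^kA^{(k)}$, where $\nabla$ is a symplectic connection and the $A^{(k)}$ are $(2,1)$-tensors with $\omega(A^{(k)}(X)Y,Z)$ totally symmetric; the value at $t=0$ is $\nabla$. It is translation invariant (on $\mathbb{R}^{2n}$) if $\nabla$ and all $A^{(k)}$ are. Its formal curvature is $R^t(X,Y)=\nabla^t_X\nabla^t_Y-\nabla^t_Y\nabla^t_X-\nabla^t_{[X,Y]}$; flat means $R^t=0$. With $R^t(X,Y;Z,T)=\omega(R^t(X,Y)Z,T)$ and $r^t(X,Y)=\operatorname{Trace}[Z\mapsto R^t(X,Z)Y]$, the curve is of Ricci type if $$R^t(X,Y;Z,T)=\tfrac{-1}{2(n+1)}\big[2\omega(X,Y)r^t(Z,T)+\omega(X,Z)r^t(Y,T)+\omega(X,T)r^t(Y,Z)-\omega(Y,Z)r^t(X,T)-\omega(Y,T)r^t(X,Z)\big].$$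 Formal curve of symplectomorphisms of $(M,\omega)$: a homomorphism of Poisson algebras $\psi_t=\psi^{(0)}+\sum_{k\ge1}t^k\psi^{(k)}:C^\infty(M)\to C^\infty(M)[[t]]$ with $\psi^{(0)}:C^\infty(M)\to C^\infty(M)$ an isomorphism; it is extended $\mathbb{R}[[t]]$-linearly to $C^\infty(M)[[t]]$. It acts on formal curves of vector fields (viewed as derivations of $C^\infty(M)[[t]]$) by $(\psi_t\cdot X_t)f=\psi_t(X_t(\psi_t^{-1}f))$ and on formal curves of symplectic connections by $(\psi_t\cdot\nabla^t)_XY=\psi_t\cdot\big(\nabla^t_{\psi_t^{-1}\cdot X}\,\psi_t^{-1}\cdot Y\big)$. *)

theory Defs
  imports
    "HOL-Analysis.Analysis"
    "HOL-Computational_Algebra.Formal_Power_Series"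
    "HOL-Library.Function_Algebras"
begin

text \<open>
  All functions and vector fields live on the vector space \<open>real ^ 'm\<close>; pointwise addition and
  multiplication of functions come from \<open>Function_Algebras\<close>, so that \<open>'m fn fps\<close> is the ring of
  formal power series with coefficients in functions. Smoothness is imposed through the carriers
  \<open>Cinf\<close>, \<open>VF\<close> below. The infix \<open>$\<close> denotes coefficients of power series, not vector components.
\<close>

type_synonym 'm fn = "(real, 'm) vec \<Rightarrow> real"
type_synonym 'm vfield = "(real, 'm) vec \<Rightarrow> (real, 'm) vec"
type_synonym 'm conn = "'m vfield \<Rightarrow> 'm vfield \<Rightarrow> 'm vfield"


unbundle no vec_syntax
unbundle fps_syntax


section \<open>Smooth functions and vector fields\<close>

text \<open>On a finite-dimensional space this is the usual notion of a function of class \<open>C\<^sup>k\<close>.\<close>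

fun Ck :: "nat \<Rightarrow> ('a::euclidean_space \<Rightarrow> 'b::real_normed_vector) \<Rightarrow> bool" where
  "Ck 0 f \<longleftrightarrow> continuous_on UNIV f"
| "Ck (Suc k) f \<longleftrightarrow>
     (\<forall>x. f differentiable (at x)) \<and> (\<forall>v. Ck k (\<lambda>x. frechet_derivative f (at x) v))"

definition smooth :: "('a::euclidean_space \<Rightarrow> 'b::real_normed_vector) \<Rightarrow> bool" where
  "smooth f \<longleftrightarrow> (\<forall>k. Ck k f)"

definition Cinf :: "('m::finite) fn set" where
  "Cinf = {f. smooth f}"

definition VF :: "('m::finite) vfield set" where
  "VF = {X. smooth X}"

definition vf_apply :: "('m::finite) vfield \<Rightarrow> 'm fn \<Rightarrow> 'm fn" where
  "vf_apply X f = (\<lambda>x. frechet_derivative f (at x) (X x))"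

definition lie_bracket :: "('m::finite) vfield \<Rightarrow> 'm vfield \<Rightarrow> 'm vfield" where
  "lie_bracket X Y =
     (\<lambda>x. frechet_derivative Y (at x) (X x) - frechet_derivative X (at x) (Y x))"

definition fn_scale :: "('m::finite) fn \<Rightarrow> 'm vfield \<Rightarrow> 'm vfield" where
  "fn_scale f X = (\<lambda>x. f x *\<^sub>R X x)"


section \<open>Symplectic vector spaces and Poisson brackets\<close>

definition symplectic_form :: "(real ^ 'm \<Rightarrow> real ^ 'm \<Rightarrow> real) \<Rightarrow> bool" where
  "symplectic_form \<Omega> \<longleftrightarrow>
     bilinear \<Omega> \<and> (\<forall>v w. \<Omega> v w = - \<Omega> w v) \<and> (\<forall>v. (\<forall>w. \<Omega> v w = 0) \<longrightarrow> v = 0)"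

definition vf_pair :: "(real ^ 'm \<Rightarrow> real ^ 'm \<Rightarrow> real) \<Rightarrow> 'm vfield \<Rightarrow> 'm vfield \<Rightarrow> 'm fn" where
  "vf_pair \<Omega> X Y = (\<lambda>x. \<Omega> (X x) (Y x))"

definition ham_vf :: "(real ^ 'm \<Rightarrow> real ^ 'm \<Rightarrow> real) \<Rightarrow> 'm fn \<Rightarrow> 'm vfield" where
  "ham_vf \<Omega> f = (\<lambda>x. THE v. \<forall>w. \<Omega> v w = frechet_derivative f (at x) w)"

text \<open>
  The sign conventions here (and in \<open>ham_vf\<close>) are immaterial: compatibility of a map with the
  bracket is unchanged if the bracket is replaced by its negative.
\<close>

definition poisson :: "(real ^ 'm \<Rightarrow> real ^ 'm \<Rightarrow> real) \<Rightarrow> 'm fn \<Rightarrow> 'm fn \<Rightarrow> 'm fn" where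
  "poisson \<Omega> f g = - vf_pair \<Omega> (ham_vf \<Omega> f) (ham_vf \<Omega> g)"


section \<open>Symplectic connections\<close>

text \<open>
  Connections and (2,1)-tensors are operators on smooth vector fields; their values on
  non-smooth arguments carry no meaning and are never constrained. A (2,1)-tensor field
  is a \<open>Cinf\<close>-bilinear map; \<open>A X Y\<close> stands for \<open>A(X)Y\<close>.
\<close>

definition linear_connection :: "('m::finite) conn \<Rightarrow> bool" where
  "linear_connection D \<longleftrightarrow>
     (\<forall>X\<in>VF. \<forall>Y\<in>VF. D X Y \<in> VF) \<and>
     (\<forall>X\<in>VF. \<forall>X'\<in>VF. \<forall>Y\<in>VF. D (X + X') Y = D X Y + D X' Y) \<and>
     (\<forall>X\<in>VF. \<forall>Y\<in>VF. \<forall>Y'\<in>VF. D X (Y + Y') = D X Y + D X Y') \<and>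
     (\<forall>f\<in>Cinf. \<forall>X\<in>VF. \<forall>Y\<in>VF. D (fn_scale f X) Y = fn_scale f (D X Y)) \<and>
     (\<forall>f\<in>Cinf. \<forall>X\<in>VF. \<forall>Y\<in>VF.
        D X (fn_scale f Y) = fn_scale (vf_apply X f) Y + fn_scale f (D X Y))"

definition torsion_free :: "('m::finite) conn \<Rightarrow> bool" where
  "torsion_free D \<longleftrightarrow> (\<forall>X\<in>VF. \<forall>Y\<in>VF. D X Y - D Y X = lie_bracket X Y)"

definition parallel_form :: "(real ^ 'm \<Rightarrow> real ^ 'm \<Rightarrow> real) \<Rightarrow> 'm conn \<Rightarrow> bool" where
  "parallel_form \<Omega> D \<longleftrightarrow> (\<forall>X\<in>VF. \<forall>Y\<in>VF. \<forall>Z\<in>VF.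
     vf_apply X (vf_pair \<Omega> Y Z) = vf_pair \<Omega> (D X Y) Z + vf_pair \<Omega> Y (D X Z))"

definition symplectic_connection :: "(real ^ 'm \<Rightarrow> real ^ 'm \<Rightarrow> real) \<Rightarrow> 'm conn \<Rightarrow> bool" where
  "symplectic_connection \<Omega> D \<longleftrightarrow> linear_connection D \<and> torsion_free D \<and> parallel_form \<Omega> D"

definition trivial_connection :: "('m::finite) conn" where
  "trivial_connection X Y = (\<lambda>x. frechet_derivative Y (at x) (X x))"

definition tensor21 :: "('m::finite) conn \<Rightarrow> bool" where
  "tensor21 A \<longleftrightarrow>
     (\<forall>X\<in>VF. \<forall>Y\<in>VF. A X Y \<in> VF) \<and>
     (\<forall>X\<in>VF. \<forall>X'\<in>VF. \<forall>Y\<in>VF. A (X + X') Y = A X Y + A X' Y) \<and>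
     (\<forall>X\<in>VF. \<forall>Y\<in>VF. \<forall>Y'\<in>VF. A X (Y + Y') = A X Y + A X Y') \<and>
     (\<forall>f\<in>Cinf. \<forall>X\<in>VF. \<forall>Y\<in>VF. A (fn_scale f X) Y = fn_scale f (A X Y)) \<and>
     (\<forall>f\<in>Cinf. \<forall>X\<in>VF. \<forall>Y\<in>VF. A X (fn_scale f Y) = fn_scale f (A X Y))"

text \<open>The two transpositions below generate all permutations of \<open>X, Y, Z\<close>.\<close>

definition totally_symmetric :: "(real ^ 'm \<Rightarrow> real ^ 'm \<Rightarrow> real) \<Rightarrow> 'm conn \<Rightarrow> bool" where
  "totally_symmetric \<Omega> A \<longleftrightarrow> (\<forall>X\<in>VF. \<forall>Y\<in>VF. \<forall>Z\<in>VF.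
     vf_pair \<Omega> (A X Y) Z = vf_pair \<Omega> (A Y X) Z \<and>
     vf_pair \<Omega> (A X Y) Z = vf_pair \<Omega> (A X Z) Y)"

text \<open>The translate of a vector field \<open>X\<close> by \<open>-a\<close> is \<open>\<lambda>x. X (x + a)\<close>.\<close>

definition translation_invariant_op :: "('m::finite) conn \<Rightarrow> bool" where
  "translation_invariant_op D \<longleftrightarrow> (\<forall>a. \<forall>X\<in>VF. \<forall>Y\<in>VF.
     D (\<lambda>x. X (x + a)) (\<lambda>x. Y (x + a)) = (\<lambda>x. D X Y (x + a)))"


section \<open>Formal curves of connections\<close>

definition formal :: "'a set \<Rightarrow> 'a fps set" where
  "formal S = {F. \<forall>k. F $ k \<in> S}"

text \<open>The extension of a bilinear operation to formal power series, bilinear over real series.\<close>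

definition fps_bilin :: "('a \<Rightarrow> 'b \<Rightarrow> 'c::comm_monoid_add) \<Rightarrow> 'a fps \<Rightarrow> 'b fps \<Rightarrow> 'c fps" where
  "fps_bilin B F G = Abs_fps (\<lambda>k. \<Sum>i\<le>k. B (F $ i) (G $ (k - i)))"

definition formal_symplectic_connection ::
    "(real ^ 'm \<Rightarrow> real ^ 'm \<Rightarrow> real) \<Rightarrow> 'm conn fps \<Rightarrow> bool" where
  "formal_symplectic_connection \<Omega> D \<longleftrightarrow>
     symplectic_connection \<Omega> (D $ 0) \<and>
     (\<forall>k\<ge>1. tensor21 (D $ k) \<and> totally_symmetric \<Omega> (D $ k))"

definition translation_invariant :: "('m::finite) conn fps \<Rightarrow> bool" where
  "translation_invariant D \<longleftrightarrow> (\<forall>k. translation_invariant_op (D $ k))"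

text \<open>Coefficient \<open>k\<close> is the sum of \<open>(D $ a) (X $ b) (Y $ c)\<close> over \<open>a + b + c = k\<close>.\<close>

definition cov :: "('m::finite) conn fps \<Rightarrow> 'm vfield fps \<Rightarrow> 'm vfield fps \<Rightarrow> 'm vfield fps" where
  "cov D X Y = Abs_fps (\<lambda>k. \<Sum>a\<le>k. fps_bilin (D $ a) X Y $ (k - a))"

definition curvature ::
    "('m::finite) conn fps \<Rightarrow> 'm vfield fps \<Rightarrow> 'm vfield fps \<Rightarrow> 'm vfield fps \<Rightarrow> 'm vfield fps" where
  "curvature D X Y Z =
     cov D X (cov D Y Z) - cov D Y (cov D X Z) - cov D (fps_bilin lie_bracket X Y) Z"

definition flat :: "('m::finite) conn fps \<Rightarrow> bool" where
  "flat D \<longleftrightarrow> (\<forall>X\<in>formal VF. \<forall>Y\<in>formal VF. \<forall>Z\<in>formal VF. curvature D X Y Z = 0)"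

definition curvature4 ::
    "(real ^ 'm \<Rightarrow> real ^ 'm \<Rightarrow> real) \<Rightarrow> 'm conn fps \<Rightarrow>
     'm vfield fps \<Rightarrow> 'm vfield fps \<Rightarrow> 'm vfield fps \<Rightarrow> 'm vfield fps \<Rightarrow> 'm fn fps" where
  "curvature4 \<Omega> D X Y Z T = fps_bilin (vf_pair \<Omega>) (curvature D X Y Z) T"

text \<open>
  The trace at the point \<open>x\<close> is over tangent vectors \<open>z\<close>; since the curvature is tensorial, \<open>z\<close> may
  be extended to the constant vector field with value \<open>z\<close>.
\<close>

definition ricci ::
    "('m::finite) conn fps \<Rightarrow> 'm vfield fps \<Rightarrow> 'm vfield fps \<Rightarrow> 'm fn fps" where
  "ricci D X Y = Abs_fps (\<lambda>k x.
     trace (matrix (\<lambda>z. (curvature D X (fps_const (\<lambda>_. z)) Y $ k) x)))"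

definition ricci_type ::
    "nat \<Rightarrow> (real ^ 'm \<Rightarrow> real ^ 'm \<Rightarrow> real) \<Rightarrow> 'm conn fps \<Rightarrow> bool" where
  "ricci_type n \<Omega> D \<longleftrightarrow>
     (let \<omega> = fps_bilin (vf_pair \<Omega>); r = ricci D in
      \<forall>X\<in>formal VF. \<forall>Y\<in>formal VF. \<forall>Z\<in>formal VF. \<forall>T\<in>formal VF.
        curvature4 \<Omega> D X Y Z T =
          fps_const (\<lambda>_. - 1 / (2 * (real n + 1))) *
            (2 * \<omega> X Y * r Z T + \<omega> X Z * r Y T + \<omega> X T * r Y Z
             - \<omega> Y Z * r X T - \<omega> Y T * r X Z))"


section \<open>Formal curves of symplectomorphisms and their action\<close>

text \<open>The extension of \<open>\<psi>\<close> to formal power series, linear over real series.\<close>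

definition fps_ext :: "('a \<Rightarrow> 'b::comm_monoid_add fps) \<Rightarrow> 'a fps \<Rightarrow> 'b fps" where
  "fps_ext \<psi> F = Abs_fps (\<lambda>k. \<Sum>i\<le>k. \<psi> (F $ i) $ (k - i))"

definition formal_symplectomorphism ::
    "(real ^ 'm \<Rightarrow> real ^ 'm \<Rightarrow> real) \<Rightarrow> ('m fn \<Rightarrow> 'm fn fps) \<Rightarrow> bool" where
  "formal_symplectomorphism \<Omega> \<psi> \<longleftrightarrow>
     (\<forall>f\<in>Cinf. \<psi> f \<in> formal Cinf) \<and>
     (\<forall>f\<in>Cinf. \<forall>g\<in>Cinf. \<psi> (f + g) = \<psi> f + \<psi> g) \<and>
     (\<forall>c. \<forall>f\<in>Cinf. \<psi> (\<lambda>x. c * f x) = fps_const (\<lambda>_. c) * \<psi> f) \<and>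
     \<psi> 1 = 1 \<and>
     (\<forall>f\<in>Cinf. \<forall>g\<in>Cinf. \<psi> (f * g) = \<psi> f * \<psi> g) \<and>
     (\<forall>f\<in>Cinf. \<forall>g\<in>Cinf. \<psi> (poisson \<Omega> f g) = fps_bilin (poisson \<Omega>) (\<psi> f) (\<psi> g)) \<and>
     bij_betw (\<lambda>f. \<psi> f $ 0) Cinf Cinf"

text \<open>
  The push-forward of a formal vector field along a bijection \<open>P\<close> of \<open>formal Cinf\<close>. Formal
  vector fields correspond bijectively to derivations of \<open>formal Cinf\<close> that are linear over
  real series, so for an algebra automorphism \<open>P\<close> linear over real series the description
  below determines a unique \<open>Y\<close>.
\<close>

definition push_vf ::
    "(('m::finite) fn fps \<Rightarrow> 'm fn fps) \<Rightarrow> 'm vfield fps \<Rightarrow> 'm vfield fps" where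
  "push_vf P X = (THE Y. Y \<in> formal VF \<and>
     (\<forall>F\<in>formal Cinf.
        fps_bilin vf_apply Y F = P (fps_bilin vf_apply X (inv_into (formal Cinf) P F))))"

definition push_conn ::
    "(('m::finite) fn fps \<Rightarrow> 'm fn fps) \<Rightarrow> 'm conn fps \<Rightarrow>
     'm vfield fps \<Rightarrow> 'm vfield fps \<Rightarrow> 'm vfield fps" where
  "push_conn P D X Y =
     (let Q = inv_into (formal Cinf) P in push_vf P (cov D (push_vf Q X) (push_vf Q Y)))"

end

(* On constant vector fields, a translation invariant curve through the trivial connection is a
   formal family of commutative products a on the vector space, and flatness means that the left
   multiplications commute. Since these are infinitesimally symplectic, the form Omega(u v w, z) is
   symmetric in u, v, w and skew in w, z, so it vanishes: all triple products are zero.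
   Consequently the formal vector field E(x) = 1/2 a(x, x) is Hamiltonian, the Lie derivative of the
   trivial connection along E is the tensor a, and the Lie derivative of a along E is zero. Hence
   exp(E) carries the trivial connection to the given curve, and the composition of exp(E') with the
   inverse of exp(E) carries one curve to the other. *)
theory Submission
  imports Defs
begin

section \<open>Calculus of smooth maps\<close>

text \<open>The general exponential of a vector field turns a connection into an infinite series of
  iterated Lie derivatives. Here the second one already vanishes, being built from triple products,
  so the series stops after its linear term. This is why \<open>E\<close> can be written down at
  once instead of being sought order by order in the formal parameter. The factor 1/2 is forced by
  the demand that the second derivative of the quadratic field \<open>E\<close> be the tensor
  \<open>a\<close>. No flow is integrated: \<open>E\<close> has no constant coefficient, so
  exponentials are computed coefficientwise by finite sums. The obstacle lies in the notion of
  action. The push-forward of a field is a definite description involving the inverse of an operator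
  on functions. Therefore every automorphism \<open>P\<close> of functions is carried together with
  an explicit companion \<open>p\<close> on vector fields, for exp(E) the exponential of the Lie
  bracket with \<open>E\<close>; a uniqueness argument identifies \<open>p\<close> with the
  push-forward. The main analytic input is the symmetry of second derivatives.\<close>

abbreviation fd :: "('a::real_normed_vector \<Rightarrow> 'b::real_normed_vector) \<Rightarrow> 'a \<Rightarrow> 'a \<Rightarrow> 'b" where
  "fd f x \<equiv> frechet_derivative f (at x)"

lemma fdI: "(f has_derivative f') (at x) \<Longrightarrow> fd f x = f'"
  using frechet_derivative_at by metis

lemma Ck_Suc_imp: "Ck (Suc k) f \<Longrightarrow> Ck k f"
proof (induction k arbitrary: f)
  case 0
  then show ?case
    by (auto intro!: continuous_at_imp_continuous_on differentiable_imp_continuous_within)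
qed simp

lemma smooth_differentiable: "smooth f \<Longrightarrow> f differentiable (at x)"
  unfolding smooth_def by (metis Ck.simps(2))

lemma smooth_has_derivative: "smooth f \<Longrightarrow> (f has_derivative fd f x) (at x)"
  using smooth_differentiable frechet_derivative_works by blast

lemma smooth_fd_linear: "smooth f \<Longrightarrow> linear (fd f x)"
  by (simp add: linear_frechet_derivative smooth_differentiable)

lemma smooth_fd: "smooth f \<Longrightarrow> smooth (\<lambda>x. fd f x v)"
  unfolding smooth_def by (metis Ck.simps(2))

lemma smooth_continuous_on: "smooth f \<Longrightarrow> continuous_on UNIV f"
  unfolding smooth_def by (metis Ck.simps(1))

lemma Ck_add:
  fixes f g :: "'a::euclidean_space \<Rightarrow> 'b::real_normed_vector"
  shows "Ck k f \<Longrightarrow> Ck k g \<Longrightarrow> Ck k (\<lambda>x. f x + g x)"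
proof (induction k arbitrary: f g)
  case 0
  then show ?case by (auto intro: continuous_on_add)
next
  case (Suc k)
  then have "fd (\<lambda>x. f x + g x) x = (\<lambda>v. fd f x v + fd g x v)" for x
    by (intro fdI has_derivative_add) (auto simp: frechet_derivative_works)
  with Suc show ?case by auto
qed

lemma Ck_const: "Ck k (\<lambda>x. c)"
proof (induction k arbitrary: c)
  case (Suc k)
  have "fd (\<lambda>x::'a. c) x = (\<lambda>v. 0)" for x
    by (intro fdI has_derivative_const)
  with Suc show ?case by simp
qed simp

text \<open>The product rule gives two terms of the same shape, each with one factor differentiated;
  the other factor is demoted from class \<open>Suc k\<close> to class \<open>k\<close>, which
  closes the induction.\<close>

lemma Ck_bounded_bilinear:
  fixes f :: "'a::euclidean_space \<Rightarrow> 'b::real_normed_vector"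
    and g :: "'a \<Rightarrow> 'c::real_normed_vector"
    and p :: "'b \<Rightarrow> 'c \<Rightarrow> 'd::real_normed_vector"
  assumes "bounded_bilinear p"
  shows "Ck k f \<Longrightarrow> Ck k g \<Longrightarrow> Ck k (\<lambda>x. p (f x) (g x))"
proof (induction k arbitrary: f g)
  case 0
  then show ?case by (auto intro: bounded_bilinear.continuous_on[OF assms])
next
  case (Suc k)
  have D: "((\<lambda>x. p (f x) (g x)) has_derivative (\<lambda>v. p (f x) (fd g x v) + p (fd f x v) (g x))) (at x)"
    for x
    by (rule bounded_bilinear.FDERIV[OF assms])
      (use Suc.prems in \<open>auto simp: frechet_derivative_works\<close>)
  have "Ck k (\<lambda>x. p (f x) (fd g x v) + p (fd f x v) (g x))" for v
    using Suc.prems Ck_Suc_imp[of k f] Ck_Suc_imp[of k g] by (intro Ck_add Suc.IH) auto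
  with D show ?case by (auto simp: fdI[OF D] differentiable_def intro!: exI)
qed

lemma smooth_const [simp]: "smooth (\<lambda>x. c)"
  by (simp add: smooth_def Ck_const)

lemma smooth_add: "smooth f \<Longrightarrow> smooth g \<Longrightarrow> smooth (\<lambda>x. f x + g x)"
  by (simp add: smooth_def Ck_add)

lemma smooth_bilinear:
  fixes p :: "'b::euclidean_space \<Rightarrow> 'c::euclidean_space \<Rightarrow> 'd::real_normed_vector"
  assumes "bilinear p" "smooth f" "smooth g"
  shows "smooth (\<lambda>x. p (f x) (g x))"
  using assms Ck_bounded_bilinear bilinear_conv_bounded_bilinear unfolding smooth_def by blast

lemma smooth_scaleR:
  fixes f :: "'a::euclidean_space \<Rightarrow> real" and g :: "'a \<Rightarrow> 'b::real_normed_vector"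
  shows "smooth f \<Longrightarrow> smooth g \<Longrightarrow> smooth (\<lambda>x. f x *\<^sub>R g x)"
  unfolding smooth_def using Ck_bounded_bilinear[OF bounded_bilinear_scaleR] by blast

lemma smooth_uminus: "smooth f \<Longrightarrow> smooth (\<lambda>x. - f x)"
  using smooth_scaleR[OF smooth_const[of "-1"]] by simp

lemma smooth_diff: "smooth f \<Longrightarrow> smooth g \<Longrightarrow> smooth (\<lambda>x. f x - g x)"
  using smooth_add[of f "\<lambda>x. - g x"] by (simp add: smooth_uminus)

lemma smooth_sum: "(\<And>i. i \<in> I \<Longrightarrow> smooth (f i)) \<Longrightarrow> smooth (\<lambda>x. \<Sum>i\<in>I. f i x)"
  by (induction I rule: infinite_finite_induct) (auto intro: smooth_add)

lemma Ck_ident: "Ck k (\<lambda>x. x)"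
proof (cases k)
  case (Suc k)
  have "fd (\<lambda>x::'a. x) x = (\<lambda>v. v)" for x
    by (intro fdI has_derivative_ident)
  with Suc show ?thesis by (simp add: Ck_const)
qed simp

lemma smooth_linear:
  fixes l :: "'a::euclidean_space \<Rightarrow> 'b::real_normed_vector"
  assumes "linear l" "smooth f"
  shows "smooth (\<lambda>x. l (f x))"
proof -
  \<comment> \<open>A linear map is read as the bilinear map \<open>c *\<^sub>R l v\<close> with
    \<open>c\<close> equal to 1, so that the product lemma covers it.\<close>
  have "bounded_bilinear (\<lambda>c v. c *\<^sub>R l v)"
    using assms(1) bounded_bilinear.comp[OF bounded_bilinear_scaleR bounded_linear_ident]
    by (simp add: linear_conv_bounded_linear)
  from Ck_bounded_bilinear[OF this Ck_const[of _ 1]] show ?thesis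
    using assms(2) by (auto simp: smooth_def)
qed

lemma smooth_ident [simp]: "smooth (\<lambda>x. x)"
  by (simp add: smooth_def Ck_ident)

text \<open>\<open>Ck\<close> controls derivatives in a fixed direction only; the expansion in basis
  vectors reduces a direction that moves with the point to fixed ones.\<close>

lemma fd_expand:
  fixes f :: "'a::euclidean_space \<Rightarrow> 'b::real_normed_vector"
  assumes "smooth f"
  shows "fd f x v = (\<Sum>b\<in>Basis. (v \<bullet> b) *\<^sub>R fd f x b)"
proof -
  have "fd f x v = fd f x (\<Sum>b\<in>Basis. (v \<bullet> b) *\<^sub>R b)"
    by (simp add: euclidean_representation)
  then show ?thesis
    using smooth_fd_linear[OF assms] by (simp add: linear_sum linear_cmul)
qed

lemma smooth_fd_app:
  fixes f :: "'a::euclidean_space \<Rightarrow> 'b::real_normed_vector"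
  assumes "smooth f" "smooth X"
  shows "smooth (\<lambda>x. fd f x (X x))"
proof -
  have "smooth (\<lambda>x. \<Sum>b\<in>Basis. (X x \<bullet> b) *\<^sub>R fd f x b)"
    using assms
    by (intro smooth_sum smooth_scaleR smooth_fd smooth_linear[of "\<lambda>x. x \<bullet> _"])
      (auto intro: bounded_linear.linear bounded_linear_inner_left)
  also have "(\<lambda>x. \<Sum>b\<in>Basis. (X x \<bullet> b) *\<^sub>R fd f x b) = (\<lambda>x. fd f x (X x))"
    by (rule ext, rule fd_expand[OF assms(1), symmetric])
  finally show ?thesis .
qed

text \<open>Product rule for the pairing of the differential with a field. In the first summand the
  direction is frozen at \<open>X x\<close> before differentiating, which is the form to which
  symmetry of second derivatives applies.\<close>

lemma fd_fd_app:
  fixes f :: "'a::euclidean_space \<Rightarrow> 'b::real_normed_vector"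
  assumes f: "smooth f" and X: "smooth X"
  shows "fd (\<lambda>x. fd f x (X x)) x h = fd (\<lambda>y. fd f y (X x)) x h + fd f x (fd X x h)"
proof -
  have e: "(\<lambda>x. fd f x (X x)) = (\<lambda>x. \<Sum>b\<in>Basis. (X x \<bullet> b) *\<^sub>R fd f x b)"
    "(\<lambda>y. fd f y (X x)) = (\<lambda>y. \<Sum>b\<in>Basis. (X x \<bullet> b) *\<^sub>R fd f y b)"
    by (rule ext, rule fd_expand[OF f])+
  have d: "((\<lambda>x. fd f x b) has_derivative fd (\<lambda>x. fd f x b) x) (at x)" for b
    using smooth_has_derivative[OF smooth_fd[OF f]] .
  have "((\<lambda>x. \<Sum>b\<in>Basis. (X x \<bullet> b) *\<^sub>R fd f x b) has_derivative
     (\<lambda>h. \<Sum>b\<in>Basis. (X x \<bullet> b) *\<^sub>R fd (\<lambda>x. fd f x b) x h + (fd X x h \<bullet> b) *\<^sub>R fd f x b)) (at x)"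
    by (intro has_derivative_sum has_derivative_scaleR d
        bounded_linear.has_derivative[OF bounded_linear_inner_left] smooth_has_derivative[OF X])
  moreover have "((\<lambda>y. \<Sum>b\<in>Basis. (X x \<bullet> b) *\<^sub>R fd f y b) has_derivative
     (\<lambda>h. \<Sum>b\<in>Basis. (X x \<bullet> b) *\<^sub>R fd (\<lambda>x. fd f x b) x h)) (at x)"
    by (intro has_derivative_sum has_derivative_scaleR_right d)
  ultimately show ?thesis
    unfolding e by (simp add: fdI sum.distrib fd_expand[OF f, of x "fd X x h"])
qed

text \<open>The mean value theorem applied twice expresses the second difference of \<open>f\<close> through
  either iterated derivative.\<close>

lemma second_difference:
  fixes f :: "'a::euclidean_space \<Rightarrow> real"
  assumes f: "smooth f" and s: "s > 0"
  obtains \<xi> \<eta> where "0 < \<xi>" "\<xi> < s" "0 < \<eta>" "\<eta> < s"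
    "f (x + s *\<^sub>R u + s *\<^sub>R v) - f (x + s *\<^sub>R u) - f (x + s *\<^sub>R v) + f x
      = s * s * fd (\<lambda>y. fd f y u) (x + \<xi> *\<^sub>R u + \<eta> *\<^sub>R v) v"
proof -
  have line: "((\<lambda>t. g (a + t *\<^sub>R w)) has_real_derivative fd g (a + t *\<^sub>R w) w) (at t)"
    if "smooth g" for g :: "'a \<Rightarrow> real" and a w t
  proof -
    have "((\<lambda>t. g (a + t *\<^sub>R w)) has_derivative (\<lambda>h. fd g (a + t *\<^sub>R w) (h *\<^sub>R w))) (at t)"
      by (rule has_derivative_compose[OF _ smooth_has_derivative[OF that]])
        (auto intro!: derivative_eq_intros)
    moreover have "fd g (a + t *\<^sub>R w) (h *\<^sub>R w) = h * fd g (a + t *\<^sub>R w) w" for h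
      using smooth_fd_linear[OF that] by (simp add: linear_cmul)
    ultimately show ?thesis
      by (simp add: has_field_derivative_def mult_commute_abs)
  qed
  \<comment> \<open>The first difference in direction \<open>v\<close>, as a function of the step
    \<open>t\<close> along \<open>u\<close>. The mean value theorem in \<open>t\<close> yields
    \<open>\<xi>\<close>; applied again along \<open>v\<close> it yields
    \<open>\<eta>\<close>.\<close>
  define \<phi> where "\<phi> t = f ((x + s *\<^sub>R v) + t *\<^sub>R u) - f (x + t *\<^sub>R u)" for t
  define \<phi>' where "\<phi>' t = fd f ((x + s *\<^sub>R v) + t *\<^sub>R u) u - fd f (x + t *\<^sub>R u) u" for t
  have "(\<phi> has_real_derivative \<phi>' t) (at t)" for t
    unfolding \<phi>_def \<phi>'_def by (intro DERIV_diff line f)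
  then obtain \<xi> where xi: "0 < \<xi>" "\<xi> < s" "\<phi> s - \<phi> 0 = s * \<phi>' \<xi>"
    using MVT2[of 0 s \<phi> \<phi>'] s by auto
  define \<theta> where "\<theta> t = fd f ((x + \<xi> *\<^sub>R u) + t *\<^sub>R v) u" for t
  have "(\<theta> has_real_derivative fd (\<lambda>y. fd f y u) ((x + \<xi> *\<^sub>R u) + t *\<^sub>R v) v) (at t)" for t
    unfolding \<theta>_def by (intro line smooth_fd f)
  then obtain \<eta> where eta: "0 < \<eta>" "\<eta> < s"
    "\<theta> s - \<theta> 0 = s * fd (\<lambda>y. fd f y u) ((x + \<xi> *\<^sub>R u) + \<eta> *\<^sub>R v) v"
    using MVT2[of 0 s \<theta> "\<lambda>t. fd (\<lambda>y. fd f y u) ((x + \<xi> *\<^sub>R u) + t *\<^sub>R v) v"] s by auto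
  have "\<theta> s - \<theta> 0 = \<phi>' \<xi>"
    by (simp add: \<theta>_def \<phi>'_def algebra_simps)
  with xi eta have "\<phi> s - \<phi> 0 = s * s * fd (\<lambda>y. fd f y u) (x + \<xi> *\<^sub>R u + \<eta> *\<^sub>R v) v"
    by simp
  moreover have "\<phi> s - \<phi> 0 = f (x + s *\<^sub>R u + s *\<^sub>R v) - f (x + s *\<^sub>R u) - f (x + s *\<^sub>R v) + f x"
    by (simp add: \<phi>_def algebra_simps)
  ultimately show ?thesis using that[of \<xi> \<eta>] xi eta by simp
qed

text \<open>The second difference is symmetric in \<open>u\<close> and \<open>v\<close>, so the two
  iterated derivatives agree at two points that tend to \<open>x\<close> with the step
  \<open>s\<close>; continuity carries the equality to \<open>x\<close>.\<close>

lemma fd_fd_sym_real: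
  fixes f :: "'a::euclidean_space \<Rightarrow> real"
  assumes f: "smooth f"
  shows "fd (\<lambda>y. fd f y u) x v = fd (\<lambda>y. fd f y v) x u"
proof -
  have close: "\<exists>d>0. \<forall>s \<xi> \<eta>. 0 < s \<and> s < d \<and> 0 < \<xi> \<and> \<xi> < s \<and> 0 < \<eta> \<and> \<eta> < s \<longrightarrow>
      \<bar>fd (\<lambda>y. fd f y u) (x + \<xi> *\<^sub>R u + \<eta> *\<^sub>R v) v - fd (\<lambda>y. fd f y u) x v\<bar> < e"
    if e: "e > 0" for e u v
  proof -
    let ?h = "\<lambda>z. fd (\<lambda>y. fd f y u) z v"
    have "continuous (at x) ?h"
      using smooth_continuous_on[OF smooth_fd[OF smooth_fd[OF f]]]
      by (simp add: continuous_on_eq_continuous_at)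
    then obtain r where r: "r > 0" "\<And>z. dist z x < r \<Longrightarrow> dist (?h z) (?h x) < e"
      using e unfolding continuous_at_eps_delta by blast
    \<comment> \<open>The summand 1 keeps the denominator positive when \<open>u\<close> and
      \<open>v\<close> vanish, and makes the estimate below strict.\<close>
    let ?d = "r / (norm u + norm v + 1)"
    have pos: "norm u + norm v + 1 > 0" by (smt (verit) norm_ge_zero)
    have "\<bar>?h (x + \<xi> *\<^sub>R u + \<eta> *\<^sub>R v) - ?h x\<bar> < e"
      if "0 < s" "s < ?d" "0 < \<xi>" "\<xi> < s" "0 < \<eta>" "\<eta> < s" for s \<xi> \<eta>
    proof -
      have "norm (\<xi> *\<^sub>R u + \<eta> *\<^sub>R v) \<le> \<xi> * norm u + \<eta> * norm v"
        using that norm_triangle_ineq[of "\<xi> *\<^sub>R u" "\<eta> *\<^sub>R v"] by simp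
      also have "\<dots> \<le> s * norm u + s * norm v"
        using that by (intro add_mono mult_right_mono) auto
      also have "\<dots> < s * (norm u + norm v + 1)" using that by (simp add: algebra_simps)
      also have "\<dots> < r" using that pos by (simp add: field_simps)
      finally have "dist (x + \<xi> *\<^sub>R u + \<eta> *\<^sub>R v) x < r" by (simp add: dist_norm add.assoc)
      from r(2)[OF this] show ?thesis by (simp add: dist_real_def)
    qed
    moreover have "?d > 0" using r pos by simp
    ultimately show ?thesis by blast
  qed
  have "\<bar>fd (\<lambda>y. fd f y u) x v - fd (\<lambda>y. fd f y v) x u\<bar> < 2 * e" if "e > 0" for e
  proof -
    from close[OF that, of u v] obtain d where d: "d > 0"
      "\<And>s \<xi> \<eta>. 0 < s \<Longrightarrow> s < d \<Longrightarrow> 0 < \<xi> \<Longrightarrow> \<xi> < s \<Longrightarrow> 0 < \<eta> \<Longrightarrow> \<eta> < s \<Longrightarrow>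
        \<bar>fd (\<lambda>y. fd f y u) (x + \<xi> *\<^sub>R u + \<eta> *\<^sub>R v) v - fd (\<lambda>y. fd f y u) x v\<bar> < e" by blast
    from close[OF that, of v u] obtain d' where d': "d' > 0"
      "\<And>s \<xi> \<eta>. 0 < s \<Longrightarrow> s < d' \<Longrightarrow> 0 < \<xi> \<Longrightarrow> \<xi> < s \<Longrightarrow> 0 < \<eta> \<Longrightarrow> \<eta> < s \<Longrightarrow>
        \<bar>fd (\<lambda>y. fd f y v) (x + \<xi> *\<^sub>R v + \<eta> *\<^sub>R u) u - fd (\<lambda>y. fd f y v) x u\<bar> < e" by blast
    define s where "s = min d d' / 2"
    have s: "0 < s" "s < d" "s < d'" using d(1) d'(1) by (auto simp: s_def)
    obtain \<xi> \<eta> where 1: "0 < \<xi>" "\<xi> < s" "0 < \<eta>" "\<eta> < s"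
      "f (x + s *\<^sub>R u + s *\<^sub>R v) - f (x + s *\<^sub>R u) - f (x + s *\<^sub>R v) + f x
        = s * s * fd (\<lambda>y. fd f y u) (x + \<xi> *\<^sub>R u + \<eta> *\<^sub>R v) v"
      using second_difference[OF f s(1)] by blast
    obtain \<xi>' \<eta>' where 2: "0 < \<xi>'" "\<xi>' < s" "0 < \<eta>'" "\<eta>' < s"
      "f (x + s *\<^sub>R v + s *\<^sub>R u) - f (x + s *\<^sub>R v) - f (x + s *\<^sub>R u) + f x
        = s * s * fd (\<lambda>y. fd f y v) (x + \<xi>' *\<^sub>R v + \<eta>' *\<^sub>R u) u"
      using second_difference[OF f s(1)] by blast
    have e: "x + s *\<^sub>R u + s *\<^sub>R v = x + s *\<^sub>R v + s *\<^sub>R u" by (simp add: algebra_simps)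
    from 1(5)[unfolded e] 2(5) have "s * s * fd (\<lambda>y. fd f y u) (x + \<xi> *\<^sub>R u + \<eta> *\<^sub>R v) v
        = s * s * fd (\<lambda>y. fd f y v) (x + \<xi>' *\<^sub>R v + \<eta>' *\<^sub>R u) u" by linarith
    then have "fd (\<lambda>y. fd f y u) (x + \<xi> *\<^sub>R u + \<eta> *\<^sub>R v) v
        = fd (\<lambda>y. fd f y v) (x + \<xi>' *\<^sub>R v + \<eta>' *\<^sub>R u) u" using s by simp
    with d(2)[OF s(1,2) 1(1-4)] d'(2)[OF s(1,3) 2(1-4)] show ?thesis by linarith
  qed
  \<comment> \<open>With half the discrepancy as \<open>e\<close>, a nonzero discrepancy would be
    smaller than itself.\<close>
  from this[of "\<bar>fd (\<lambda>y. fd f y u) x v - fd (\<lambda>y. fd f y v) x u\<bar> / 2"] show ?thesis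
    by fastforce
qed

lemma fd_linear_comp:
  fixes l :: "'b::euclidean_space \<Rightarrow> 'c::real_normed_vector"
  assumes "linear l" "smooth f"
  shows "fd (\<lambda>x. l (f x)) x v = l (fd f x v)"
proof -
  have "((\<lambda>x. l (f x)) has_derivative (\<lambda>v. l (fd f x v))) (at x)"
    using assms linear_conv_bounded_linear
    by (blast intro: bounded_linear.has_derivative smooth_has_derivative)
  from fdI[OF this] show ?thesis by simp
qed

lemma fd_fd_sym:
  fixes f :: "'a::euclidean_space \<Rightarrow> 'b::euclidean_space"
  assumes f: "smooth f"
  shows "fd (\<lambda>y. fd f y u) x v = fd (\<lambda>y. fd f y v) x u"
proof (rule euclidean_eqI)
  fix b :: 'b
  have l: "linear (\<lambda>z::'b. z \<bullet> b)"
    by (rule bounded_linear.linear[OF bounded_linear_inner_left])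
  have "fd (\<lambda>y. fd f y u) x v \<bullet> b = fd (\<lambda>y. fd (\<lambda>x. f x \<bullet> b) y u) x v" for u v
    using fd_linear_comp[OF l f] fd_linear_comp[OF l smooth_fd[OF f]] by simp
  then show "fd (\<lambda>y. fd f y u) x v \<bullet> b = fd (\<lambda>y. fd f y v) x u \<bullet> b"
    using fd_fd_sym_real[OF smooth_linear[OF l f]] by simp
qed

lemma fd_add:
  "smooth f \<Longrightarrow> smooth g \<Longrightarrow> fd (\<lambda>x. f x + g x) x v = fd f x v + fd g x v"
  by (simp add: fdI[OF has_derivative_add[OF smooth_has_derivative smooth_has_derivative]])

lemma fd_diff:
  "smooth f \<Longrightarrow> smooth g \<Longrightarrow> fd (\<lambda>x. f x - g x) x v = fd f x v - fd g x v"
  by (simp add: fdI[OF has_derivative_diff[OF smooth_has_derivative smooth_has_derivative]])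

lemma fd_scaleR_const: "smooth f \<Longrightarrow> fd (\<lambda>x. c *\<^sub>R f x) x v = c *\<^sub>R fd f x v"
  by (simp add: fdI[OF has_derivative_scaleR_right[OF smooth_has_derivative]])

lemma fd_const [simp]: "fd (\<lambda>x. c) x v = 0"
  by (simp add: fdI[OF has_derivative_const])

lemma fd_bilinear:
  fixes p :: "'b::euclidean_space \<Rightarrow> 'c::euclidean_space \<Rightarrow> 'd::real_normed_vector"
  assumes "bilinear p" "smooth f" "smooth g"
  shows "fd (\<lambda>x. p (f x) (g x)) x v = p (f x) (fd g x v) + p (fd f x v) (g x)"
  using fdI[OF bounded_bilinear.FDERIV[of p f _ x UNIV g,
      OF _ smooth_has_derivative smooth_has_derivative]] assms
  by (simp add: bilinear_conv_bounded_bilinear)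

lemma fd_mult:
  fixes f g :: "'a::euclidean_space \<Rightarrow> real"
  assumes "smooth f" "smooth g"
  shows "fd (\<lambda>x. f x * g x) x v = f x * fd g x v + fd f x v * g x"
  by (simp add: fdI[OF bounded_bilinear.FDERIV[OF bounded_bilinear_mult
        smooth_has_derivative[OF assms(1)] smooth_has_derivative[OF assms(2)]]])

section \<open>Exponentials of order-raising operators\<close>

text \<open>These instances let \<open>subspace\<close> and scalar multiplication apply alike to
  functions, vector fields and their series, so that one theory of exponentials serves all of
  them.\<close>

instantiation "fun" :: (type, real_vector) real_vector
begin

definition scaleR_fun :: "real \<Rightarrow> ('a \<Rightarrow> 'b) \<Rightarrow> 'a \<Rightarrow> 'b" where
  "scaleR_fun c f = (\<lambda>x. c *\<^sub>R f x)"

instance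
  by standard (auto simp: scaleR_fun_def fun_eq_iff algebra_simps)

end

instantiation fps :: (real_vector) real_vector
begin

definition scaleR_fps :: "real \<Rightarrow> 'a fps \<Rightarrow> 'a fps" where
  "scaleR_fps c F = Abs_fps (\<lambda>k. c *\<^sub>R (F $ k))"

instance
  by standard (auto simp: scaleR_fps_def fps_eq_iff algebra_simps)

end

lemma scaleR_fun_apply [simp]: "(c *\<^sub>R f) x = c *\<^sub>R f x"
  by (simp add: scaleR_fun_def)

lemma sum_fun_apply: "(\<Sum>i\<in>I. f i) x = (\<Sum>i\<in>I. f i x)"
  by (induction I rule: infinite_finite_induct) auto

lemma fps_scaleR_nth [simp]: "(c *\<^sub>R F) $ k = c *\<^sub>R (F $ k)"
  by (simp add: scaleR_fps_def)

lemma formal_nth: "F \<in> formal S \<Longrightarrow> F $ k \<in> S"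
  by (simp add: formal_def)

lemma formalI: "(\<And>k. F $ k \<in> S) \<Longrightarrow> F \<in> formal S"
  by (simp add: formal_def)

lemma subspace_formal: "subspace S \<Longrightarrow> subspace (formal S)"
  by (auto simp: subspace_def formal_def)

section \<open>Order in the formal parameter and bilinear maps that respect it\<close>

definition vanishes :: "nat \<Rightarrow> 'a::zero fps \<Rightarrow> bool" where
  "vanishes n F \<longleftrightarrow> (\<forall>i<n. F $ i = 0)"

lemma vanishes_0 [simp]: "vanishes 0 F"
  by (simp add: vanishes_def)

lemma vanishes_scaleR: "vanishes n F \<Longrightarrow> vanishes n (c *\<^sub>R F)"
  by (simp add: vanishes_def)

text \<open>Bilinearity is relative to subspaces because the operations obey their laws only on
  smooth arguments.\<close>

definition bilin_on ::
    "'a::real_vector set \<Rightarrow> 'b::real_vector set \<Rightarrow> 'c::real_vector set \<Rightarrow> ('a \<Rightarrow> 'b \<Rightarrow> 'c) \<Rightarrow> bool" where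
  "bilin_on S T U B \<longleftrightarrow> subspace S \<and> subspace T \<and> subspace U \<and>
     (\<forall>x\<in>S. \<forall>y\<in>T. B x y \<in> U) \<and>
     (\<forall>x\<in>S. \<forall>x'\<in>S. \<forall>y\<in>T. B (x + x') y = B x y + B x' y) \<and>
     (\<forall>x\<in>S. \<forall>y\<in>T. \<forall>y'\<in>T. B x (y + y') = B x y + B x y') \<and>
     (\<forall>c. \<forall>x\<in>S. \<forall>y\<in>T. B (c *\<^sub>R x) y = c *\<^sub>R B x y) \<and>
     (\<forall>c. \<forall>x\<in>S. \<forall>y\<in>T. B x (c *\<^sub>R y) = c *\<^sub>R B x y)"

context
  fixes S :: "'a::real_vector set" and T :: "'b::real_vector set" and U :: "'c::real_vector set"
    and B :: "'a \<Rightarrow> 'b \<Rightarrow> 'c"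
  assumes B: "bilin_on S T U B"
begin

lemma bilin_on_closed: "x \<in> S \<Longrightarrow> y \<in> T \<Longrightarrow> B x y \<in> U"
  using B by (simp add: bilin_on_def)

lemma bilin_on_add_left: "x \<in> S \<Longrightarrow> x' \<in> S \<Longrightarrow> y \<in> T \<Longrightarrow> B (x + x') y = B x y + B x' y"
  using B by (simp add: bilin_on_def)

lemma bilin_on_add_right: "x \<in> S \<Longrightarrow> y \<in> T \<Longrightarrow> y' \<in> T \<Longrightarrow> B x (y + y') = B x y + B x y'"
  using B by (simp add: bilin_on_def)

lemma bilin_on_scale_left: "x \<in> S \<Longrightarrow> y \<in> T \<Longrightarrow> B (c *\<^sub>R x) y = c *\<^sub>R B x y"
  using B by (simp add: bilin_on_def)

lemma bilin_on_scale_right: "x \<in> S \<Longrightarrow> y \<in> T \<Longrightarrow> B x (c *\<^sub>R y) = c *\<^sub>R B x y"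
  using B by (simp add: bilin_on_def)

lemma bilin_on_subspace: "subspace S" "subspace T" "subspace U"
  using B by (simp_all add: bilin_on_def)

lemma bilin_on_zero_left: "y \<in> T \<Longrightarrow> B 0 y = 0"
  using bilin_on_scale_left[of 0 y 0] bilin_on_subspace by (simp add: subspace_0)

lemma bilin_on_zero_right: "x \<in> S \<Longrightarrow> B x 0 = 0"
  using bilin_on_scale_right[of x 0 0] bilin_on_subspace by (simp add: subspace_0)

lemma bilin_on_diff_left:
  assumes "x \<in> S" "x' \<in> S" "y \<in> T"
  shows "B (x - x') y = B x y - B x' y"
  using bilin_on_add_left[of "x - x'" x' y] assms bilin_on_subspace by (simp add: subspace_diff)

lemma bilin_on_diff_right:
  assumes "x \<in> S" "y \<in> T" "y' \<in> T"
  shows "B x (y - y') = B x y - B x y'"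
  using bilin_on_add_right[of x "y - y'" y'] assms bilin_on_subspace by (simp add: subspace_diff)

lemma bilin_on_sum_left:
  "finite I \<Longrightarrow> (\<And>i. i \<in> I \<Longrightarrow> f i \<in> S) \<Longrightarrow> y \<in> T \<Longrightarrow> B (\<Sum>i\<in>I. f i) y = (\<Sum>i\<in>I. B (f i) y)"
  by (induction I rule: finite_induct)
    (simp_all add: bilin_on_zero_left bilin_on_add_left subspace_sum bilin_on_subspace)

lemma bilin_on_sum_right:
  "finite I \<Longrightarrow> (\<And>i. i \<in> I \<Longrightarrow> f i \<in> T) \<Longrightarrow> x \<in> S \<Longrightarrow> B x (\<Sum>i\<in>I. f i) = (\<Sum>i\<in>I. B x (f i))"
  by (induction I rule: finite_induct)
    (simp_all add: bilin_on_zero_right bilin_on_add_right subspace_sum bilin_on_subspace)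

end

text \<open>The order condition is continuity for the topology of formal power series; it is what
  permits truncating the arguments.\<close>

definition graded_bilin ::
    "'a::real_vector fps set \<Rightarrow> 'b::real_vector fps set \<Rightarrow> 'c::real_vector fps set
      \<Rightarrow> ('a fps \<Rightarrow> 'b fps \<Rightarrow> 'c fps) \<Rightarrow> bool" where
  "graded_bilin S T U B \<longleftrightarrow> bilin_on S T U B \<and>
     (\<forall>F\<in>S. \<forall>G\<in>T. \<forall>n m. vanishes n F \<longrightarrow> vanishes m G \<longrightarrow> vanishes (n + m) (B F G))"

lemma graded_bilin_bilin: "graded_bilin S T U B \<Longrightarrow> bilin_on S T U B"
  by (simp add: graded_bilin_def)

text \<open>Changing one argument at a time writes the difference as
  \<open>B (F - F') G + B F' (G - G')\<close>, and both terms have order at least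
  \<open>m\<close>.\<close>

lemma graded_bilin_cong:
  assumes B: "graded_bilin S T U B" and "F \<in> S" "F' \<in> S" "G \<in> T" "G' \<in> T"
    and "vanishes m (F - F')" "vanishes m (G - G')" "k < m"
  shows "B F G $ k = B F' G' $ k"
proof -
  have b: "bilin_on S T U B" and o: "\<And>F G n m. F \<in> S \<Longrightarrow> G \<in> T \<Longrightarrow> vanishes n F \<Longrightarrow> vanishes m G \<Longrightarrow>
      vanishes (n + m) (B F G)"
    using B by (auto simp: graded_bilin_def)
  note sp = bilin_on_subspace[OF b]
  have "B F G - B F' G' = B (F - F') G + B F' (G - G')"
    using assms by (simp add: bilin_on_diff_left[OF b] bilin_on_diff_right[OF b])
  moreover have "vanishes m (B (F - F') G)" "vanishes m (B F' (G - G'))"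
    using assms sp o[of "F - F'" G m 0] o[of F' "G - G'" 0 m] by (simp_all add: subspace_diff)
  ultimately have "(B F G - B F' G') $ k = 0"
    using assms(8) by (simp add: vanishes_def)
  then show ?thesis by simp
qed

lemma fps_bilin_nth: "fps_bilin B F G $ k = (\<Sum>i\<le>k. B (F $ i) (G $ (k - i)))"
  by (simp add: fps_bilin_def)

lemma fps_bilin_graded:
  assumes B: "bilin_on S T U B"
  shows "graded_bilin (formal S) (formal T) (formal U) (fps_bilin B)"
proof -
  note sp = bilin_on_subspace[OF B]
  have "bilin_on (formal S) (formal T) (formal U) (fps_bilin B)"
    unfolding bilin_on_def
    using sp by (auto simp: subspace_formal fps_eq_iff fps_bilin_nth formal_nth
        bilin_on_add_left[OF B] bilin_on_add_right[OF B] bilin_on_scale_left[OF B]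
        bilin_on_scale_right[OF B] sum.distrib scaleR_right.sum
        intro!: formalI subspace_sum bilin_on_closed[OF B])
  moreover have "vanishes (n + m) (fps_bilin B F G)"
    if "F \<in> formal S" "G \<in> formal T" "vanishes n F" "vanishes m G" for F G n m
    unfolding vanishes_def fps_bilin_nth
  proof (intro allI impI sum.neutral ballI)
    fix i j assume "i < n + m" "j \<in> {..i}"
    then have "j < n \<or> i - j < m" by auto
    then show "B (F $ j) (G $ (i - j)) = 0"
      using that by (auto simp: vanishes_def bilin_on_zero_left[OF B] bilin_on_zero_right[OF B] formal_nth)
  qed
  ultimately show ?thesis by (simp add: graded_bilin_def)
qed

lemma fps_bilin_bilin:
  "bilin_on S T U B \<Longrightarrow> bilin_on (formal S) (formal T) (formal U) (fps_bilin B)"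
  by (intro graded_bilin_bilin fps_bilin_graded)

section \<open>Order-raising operators and their exponential series\<close>

definition raising :: "'a::real_vector fps set \<Rightarrow> ('a fps \<Rightarrow> 'a fps) \<Rightarrow> bool" where
  "raising S L \<longleftrightarrow> subspace S \<and> (\<forall>F\<in>S. L F \<in> S) \<and>
     (\<forall>F\<in>S. \<forall>G\<in>S. L (F + G) = L F + L G) \<and> (\<forall>c. \<forall>F\<in>S. L (c *\<^sub>R F) = c *\<^sub>R L F) \<and>
     (\<forall>n. \<forall>F\<in>S. vanishes n F \<longrightarrow> vanishes (Suc n) (L F))"

text \<open>A series without constant coefficient has order at least one, and orders add. This is
  the source of all the operators exponentiated later: a formal field acting on functions by
  derivation and on fields by bracket.\<close>

lemma raising_fps_bilin:
  assumes B: "bilin_on S T T B" and E: "E \<in> formal S" "E $ 0 = 0"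
  shows "raising (formal T) (fps_bilin B E)"
proof -
  have b: "bilin_on (formal S) (formal T) (formal T) (fps_bilin B)"
    and o: "\<And>G m. G \<in> formal T \<Longrightarrow> vanishes 1 E \<Longrightarrow> vanishes m G \<Longrightarrow> vanishes (1 + m) (fps_bilin B E G)"
    using fps_bilin_graded[OF B] E(1) unfolding graded_bilin_def by blast+
  show ?thesis
    using E o bilin_on_subspace[OF b]
    by (auto simp: raising_def bilin_on_closed[OF b] bilin_on_add_right[OF b]
        bilin_on_scale_right[OF b] vanishes_def)
qed

text \<open>Since \<open>L\<close> raises the order in the formal parameter, each coefficient of the exponential
  series of \<open>L\<close> is a finite sum.\<close>

definition divpow :: "('a::real_vector fps \<Rightarrow> 'a fps) \<Rightarrow> 'a fps \<Rightarrow> nat \<Rightarrow> 'a fps" where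
  "divpow L F n = (1 / fact n) *\<^sub>R (L ^^ n) F"

definition fexp :: "('a::real_vector fps \<Rightarrow> 'a fps) \<Rightarrow> 'a fps \<Rightarrow> 'a fps" where
  "fexp L F = Abs_fps (\<lambda>k. \<Sum>n\<le>k. divpow L F n $ k)"

lemma divpow_0 [simp]: "divpow L F 0 = F"
  by (simp add: divpow_def)

context
  fixes S :: "'a::real_vector fps set" and L :: "'a fps \<Rightarrow> 'a fps"
  assumes L: "raising S L"
begin

lemma raising_subspace: "subspace S"
  using L by (simp add: raising_def)

lemma raising_closed: "F \<in> S \<Longrightarrow> L F \<in> S"
  using L by (simp add: raising_def)

lemma raising_add: "F \<in> S \<Longrightarrow> G \<in> S \<Longrightarrow> L (F + G) = L F + L G"
  using L by (simp add: raising_def)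

lemma raising_scale: "F \<in> S \<Longrightarrow> L (c *\<^sub>R F) = c *\<^sub>R L F"
  using L by (simp add: raising_def)

lemma raising_vanishes: "F \<in> S \<Longrightarrow> vanishes n F \<Longrightarrow> vanishes (Suc n) (L F)"
  using L by (simp add: raising_def)

lemma raising_zero: "L 0 = 0"
  using raising_scale[of 0 0] subspace_0[OF raising_subspace] by simp

lemma raising_sum:
  "finite I \<Longrightarrow> (\<And>i. i \<in> I \<Longrightarrow> f i \<in> S) \<Longrightarrow> L (\<Sum>i\<in>I. f i) = (\<Sum>i\<in>I. L (f i))"
  by (induction I rule: finite_induct)
    (simp_all add: raising_zero raising_add subspace_sum raising_subspace)

lemma raising_uminus: "raising S (\<lambda>F. - L F)"
  unfolding raising_def
  using raising_subspace raising_vanishes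
  by (auto simp: raising_add raising_scale vanishes_def raising_closed subspace_neg)

lemma raising_pow_closed: "F \<in> S \<Longrightarrow> (L ^^ n) F \<in> S"
  by (induction n) (auto intro: raising_closed)

lemma raising_pow_vanishes: "F \<in> S \<Longrightarrow> vanishes m F \<Longrightarrow> vanishes (m + n) ((L ^^ n) F)"
  by (induction n) (auto intro: raising_vanishes raising_pow_closed)

lemma raising_pow_add: "F \<in> S \<Longrightarrow> G \<in> S \<Longrightarrow> (L ^^ n) (F + G) = (L ^^ n) F + (L ^^ n) G"
  by (induction n) (auto simp: raising_add raising_pow_closed)

lemma raising_pow_scale: "F \<in> S \<Longrightarrow> (L ^^ n) (c *\<^sub>R F) = c *\<^sub>R (L ^^ n) F"
  by (induction n) (auto simp: raising_scale raising_pow_closed)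

lemma divpow_closed: "F \<in> S \<Longrightarrow> divpow L F n \<in> S"
  by (simp add: divpow_def raising_pow_closed raising_subspace subspace_scale)

lemma divpow_vanishes: "F \<in> S \<Longrightarrow> vanishes m F \<Longrightarrow> vanishes (m + n) (divpow L F n)"
  by (simp add: divpow_def raising_pow_vanishes vanishes_scaleR)

lemma divpow_Suc: "F \<in> S \<Longrightarrow> L (divpow L F n) = real (Suc n) *\<^sub>R divpow L F (Suc n)"
  by (simp add: divpow_def raising_scale raising_pow_closed del: of_nat_Suc)

lemma divpow_add: "F \<in> S \<Longrightarrow> G \<in> S \<Longrightarrow> divpow L (F + G) n = divpow L F n + divpow L G n"
  by (simp add: divpow_def raising_pow_add scaleR_add_right)

lemma divpow_sum_closed: "F \<in> S \<Longrightarrow> (\<Sum>n\<le>N. divpow L F n) \<in> S"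
  by (intro subspace_sum raising_subspace divpow_closed)

text \<open>Terms with index above \<open>k\<close> have order above \<open>k\<close>, so every
  cutoff from \<open>k\<close> on gives the same coefficient; a single truncation thus serves
  several coefficients.\<close>

lemma fexp_nth:
  assumes "F \<in> S" "k \<le> N"
  shows "fexp L F $ k = (\<Sum>n\<le>N. divpow L F n) $ k"
proof -
  have "divpow L F n $ k = 0" if "n > k" for n
    using divpow_vanishes[OF assms(1), of 0 n] that by (auto simp: vanishes_def)
  then have "(\<Sum>n\<le>k. divpow L F n $ k) = (\<Sum>n\<le>N. divpow L F n $ k)"
    using assms(2) by (intro sum.mono_neutral_left) auto
  then show ?thesis by (simp add: fexp_def fps_sum_nth)
qed

lemma fexp_truncate: "F \<in> S \<Longrightarrow> vanishes (Suc N) (fexp L F - (\<Sum>n\<le>N. divpow L F n))"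
  by (auto simp: vanishes_def fexp_nth)

lemma fexp_add: "F \<in> S \<Longrightarrow> G \<in> S \<Longrightarrow> fexp L (F + G) = fexp L F + fexp L G"
  by (simp add: fps_eq_iff fexp_def divpow_add sum.distrib)

lemma fexp_vanishes: "F \<in> S \<Longrightarrow> vanishes m F \<Longrightarrow> vanishes m (fexp L F)"
  using divpow_vanishes by (auto simp: vanishes_def fexp_def intro!: sum.neutral)

text \<open>For constants and for the formal parameter, which derivations annihilate.\<close>

lemma fexp_fixed:
  assumes "L F = 0"
  shows "fexp L F = F"
proof -
  have "(L ^^ Suc n) F = 0" for n
    by (induction n) (use assms raising_zero in auto)
  then have "divpow L F n = 0" if "n > 0" for n
    using that gr0_implies_Suc[OF that] by (auto simp: divpow_def)
  then have "(\<Sum>n\<le>k. divpow L F n $ k) = (\<Sum>n\<in>{0}. divpow L F n $ k)" for k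
    by (intro sum.mono_neutral_right) auto
  then show ?thesis by (simp add: fexp_def fps_eq_iff)
qed

end

lemma fexp_closed:
  assumes "raising (formal S) L" "subspace S" "F \<in> formal S"
  shows "fexp L F \<in> formal S"
proof (rule formalI)
  fix k
  have "divpow L F n $ k \<in> S" for n
    by (rule formal_nth[OF divpow_closed[OF assms(1,3)]])
  then show "fexp L F $ k \<in> S"
    by (simp add: fexp_def subspace_sum assms(2))
qed

text \<open>A product of two truncated exponential series runs over a square of indices. Terms of
  total degree above \<open>k\<close> drop out for reasons of order, and the rest is regrouped by
  total degree.\<close>

lemma sum_square_triangle:
  fixes h :: "nat \<Rightarrow> nat \<Rightarrow> 'a::comm_monoid_add"
  assumes "\<And>n m. n + m > k \<Longrightarrow> h n m = 0"
  shows "(\<Sum>n\<le>k. \<Sum>m\<le>k. h n m) = (\<Sum>N\<le>k. \<Sum>n\<le>N. h n (N - n))"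
proof -
  have "(\<Sum>n\<le>k. \<Sum>m\<le>k. h n m) = (\<Sum>(n, m)\<in>{..k} \<times> {..k}. h n m)"
    by (simp add: sum.cartesian_product)
  also have "\<dots> = (\<Sum>(n, m)\<in>{(n, m). n + m \<le> k}. h n m)"
    using assms by (intro sum.mono_neutral_right) (auto, metis not_le)
  finally show ?thesis by (simp add: sum.triangle_reindex_eq)
qed

text \<open>In the product of the two series, the power \<open>L ^^ N\<close> has the coefficient (1
  + (-1))^N / N! by the binomial theorem, which is 1 for \<open>N = 0\<close> and 0
  otherwise.\<close>

lemma fexp_uminus_inverse:
  assumes L: "raising (formal S) L" and S: "subspace S" and F: "F \<in> formal S"
  shows "fexp L (fexp (\<lambda>F. - L F) F) = F"
proof (rule fps_ext)
  fix k
  let ?M = "\<lambda>F. - L F"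
  let ?G = "\<Sum>m\<le>k. divpow ?M F m"
  have M: "raising (formal S) ?M" using raising_uminus[OF L] .
  have Mn: "(?M ^^ n) F = ((-1) ^ n) *\<^sub>R (L ^^ n) F" for n
  proof (induction n)
    case (Suc n)
    then show ?case
      using raising_scale[OF L raising_pow_closed[OF L F], of "(-1)^n" n] by simp
  qed simp
  have G: "?G \<in> formal S" using divpow_sum_closed[OF M F] .
  have eG: "fexp ?M F - ?G \<in> formal S"
    using fexp_closed[OF M S F] G subspace_formal[OF S] by (simp add: subspace_diff)
  \<comment> \<open>The tail cut off from the inner series has order above \<open>k\<close>, and
    \<open>fexp L\<close> does not lower orders.\<close>
  have "fexp L (fexp ?M F) = fexp L ?G + fexp L (fexp ?M F - ?G)"
    using fexp_add[OF L G eG] by simp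
  moreover have "fexp L (fexp ?M F - ?G) $ k = 0"
    using fexp_vanishes[OF L eG fexp_truncate[OF M F]] by (simp add: vanishes_def)
  ultimately have "fexp L (fexp ?M F) $ k = (\<Sum>n\<le>k. divpow L ?G n $ k)"
    by (simp add: fexp_def)
  also have "\<dots> = (\<Sum>n\<le>k. \<Sum>m\<le>k. ((1 / fact n) * ((-1) ^ m / fact m)) *\<^sub>R ((L ^^ (n + m)) F $ k))"
  proof (rule sum.cong[OF refl])
    fix n
    have "(L ^^ n) ?G = (\<Sum>m\<le>k. (L ^^ n) (divpow ?M F m))"
    proof (induction n)
      case (Suc n)
      then show ?case
        by (simp add: raising_sum[OF L] raising_pow_closed[OF L] divpow_closed[OF M F])
    qed simp
    also have "\<dots> = (\<Sum>m\<le>k. ((-1) ^ m / fact m) *\<^sub>R (L ^^ (n + m)) F)"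
      by (simp add: divpow_def Mn raising_pow_scale[OF L] raising_pow_closed[OF L F] funpow_add)
    finally show "divpow L ?G n $ k
        = (\<Sum>m\<le>k. ((1 / fact n) * ((-1) ^ m / fact m)) *\<^sub>R ((L ^^ (n + m)) F $ k))"
      by (simp add: divpow_def[of L] fps_sum_nth scaleR_right.sum)
  qed
  also have "\<dots> = (\<Sum>N\<le>k. \<Sum>n\<le>N. ((1 / fact n) * ((-1) ^ (N - n) / fact (N - n))) *\<^sub>R ((L ^^ (n + (N - n))) F $ k))"
    using raising_pow_vanishes[OF L F, of 0]
    by (intro sum_square_triangle) (auto simp: vanishes_def)
  also have "\<dots> = (\<Sum>N\<le>k. (\<Sum>n\<le>N. (1 / fact n) * ((-1) ^ (N - n) / fact (N - n))) *\<^sub>R ((L ^^ N) F $ k))"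
    by (intro sum.cong refl) (simp add: scaleR_left.sum)
  also have "\<dots> = (\<Sum>N\<le>k. (if N = 0 then 1 else 0) *\<^sub>R ((L ^^ N) F $ k))"
  proof (intro sum.cong refl arg_cong2[where f = scaleR])
    fix N
    have "(\<Sum>n\<le>N. (1 / fact n) * ((-1) ^ (N - n) / fact (N - n)))
        = (\<Sum>n\<le>N. real (N choose n) * 1 ^ n * (-1) ^ (N - n)) / fact N"
      unfolding sum_divide_distrib by (intro sum.cong refl) (simp add: binomial_fact)
    also have "\<dots> = (1 + (-1)) ^ N / fact N"
      by (simp only: binomial_ring)
    finally show "(\<Sum>n\<le>N. (1 / fact n) * ((-1) ^ (N - n) / fact (N - n))) = (if N = 0 then 1 else 0::real)"
      by simp
  qed
  also have "\<dots> = (\<Sum>N\<le>k. if N = 0 then F $ k else 0)"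
    by (intro sum.cong refl) auto
  also have "\<dots> = F $ k"
    by simp
  finally show "fexp L (fexp ?M F) $ k = F $ k" .
qed

lemma fexp_uminus_inverse':
  assumes L: "raising (formal S) L" and S: "subspace S" and F: "F \<in> formal S"
  shows "fexp (\<lambda>F. - L F) (fexp L F) = F"
  using fexp_uminus_inverse[OF raising_uminus[OF L] S F] by simp

text \<open>The sum is the degree \<open>N\<close> part of the product of two exponential series.
  Differentiating the left or the right factor gives terms of degree \<open>Suc N\<close> with
  weights \<open>n\<close> and \<open>Suc N - n\<close>, and these weights add up to
  \<open>Suc N\<close>.\<close>

lemma leibniz_divpow:
  assumes L1: "raising S L1" and L2: "raising T L2" and L3: "raising U L3"
    and B: "bilin_on S T U B" and F: "F \<in> S" and G: "G \<in> T"
    and der: "\<And>F G. F \<in> S \<Longrightarrow> G \<in> T \<Longrightarrow> L3 (B F G) = B (L1 F) G + B F (L2 G) + C F G"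
  shows "L3 (\<Sum>n\<le>N. B (divpow L1 F n) (divpow L2 G (N - n)))
    = real (Suc N) *\<^sub>R (\<Sum>n\<le>Suc N. B (divpow L1 F n) (divpow L2 G (Suc N - n)))
      + (\<Sum>n\<le>N. C (divpow L1 F n) (divpow L2 G (N - n)))"
proof -
  let ?x = "divpow L1 F" and ?y = "divpow L2 G"
  note x = divpow_closed[OF L1 F] and y = divpow_closed[OF L2 G]
  have "L3 (\<Sum>n\<le>N. B (?x n) (?y (N - n))) =
      (\<Sum>n\<le>N. real (Suc n) *\<^sub>R B (?x (Suc n)) (?y (N - n)))
      + (\<Sum>n\<le>N. real (Suc (N - n)) *\<^sub>R B (?x n) (?y (Suc (N - n))))
      + (\<Sum>n\<le>N. C (?x n) (?y (N - n)))"
    by (simp add: raising_sum[OF L3] bilin_on_closed[OF B] x y der divpow_Suc[OF L1 F] divpow_Suc[OF L2 G]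
        bilin_on_scale_left[OF B] bilin_on_scale_right[OF B] sum.distrib del: of_nat_Suc)
  \<comment> \<open>After the shift, the additional term at \<open>n = 0\<close> carries the weight
    0. In the next sum the additional term at \<open>n = Suc N\<close> does.\<close>
  also have "(\<Sum>n\<le>N. real (Suc n) *\<^sub>R B (?x (Suc n)) (?y (N - n)))
      = (\<Sum>n\<le>Suc N. real n *\<^sub>R B (?x n) (?y (Suc N - n)))"
    by (subst sum.atMost_Suc_shift) simp
  also have "(\<Sum>n\<le>N. real (Suc (N - n)) *\<^sub>R B (?x n) (?y (Suc (N - n))))
      = (\<Sum>n\<le>Suc N. real (Suc N - n) *\<^sub>R B (?x n) (?y (Suc N - n)))"
  proof -
    have "(\<Sum>n\<le>N. real (Suc (N - n)) *\<^sub>R B (?x n) (?y (Suc (N - n))))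
        = (\<Sum>n\<le>N. real (Suc N - n) *\<^sub>R B (?x n) (?y (Suc N - n)))"
      by (intro sum.cong refl) (simp only: atMost_iff Suc_diff_le)
    then show ?thesis
      by (simp only: sum.atMost_Suc diff_self_eq_0 of_nat_0 scaleR_zero_left add_0_right)
  qed
  also have "(\<Sum>n\<le>Suc N. real n *\<^sub>R B (?x n) (?y (Suc N - n)))
      + (\<Sum>n\<le>Suc N. real (Suc N - n) *\<^sub>R B (?x n) (?y (Suc N - n)))
      = (\<Sum>n\<le>Suc N. real (Suc N) *\<^sub>R B (?x n) (?y (Suc N - n)))"
    unfolding sum.distrib[symmetric] scaleR_add_left[symmetric]
    by (intro sum.cong refl) (simp add: of_nat_diff)
  finally show ?thesis by (simp only: scaleR_right.sum)
qed

text \<open>The case \<open>C = 0\<close> says that the exponential of a derivation is an automorphism. For a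
  covariant derivative \<open>B\<close>, the defect \<open>C\<close> is the Lie derivative of the connection.\<close>

lemma fexp_leibniz:
  assumes L1: "raising S L1" and L2: "raising T L2" and L3: "raising U L3"
    and B: "graded_bilin S T U B" and C: "graded_bilin S T U C"
    and F: "F \<in> S" "fexp L1 F \<in> S" and G: "G \<in> T" "fexp L2 G \<in> T"
    and derB: "\<And>F G. F \<in> S \<Longrightarrow> G \<in> T \<Longrightarrow> L3 (B F G) = B (L1 F) G + B F (L2 G) + C F G"
    and derC: "\<And>F G. F \<in> S \<Longrightarrow> G \<in> T \<Longrightarrow> L3 (C F G) = C (L1 F) G + C F (L2 G)"
  shows "fexp L3 (B F G) = B (fexp L1 F) (fexp L2 G) + C (fexp L1 F) (fexp L2 G)"
proof (rule fps_ext)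
  fix k
  let ?x = "divpow L1 F" and ?y = "divpow L2 G"
  note x = divpow_closed[OF L1 F(1)] and y = divpow_closed[OF L2 G(1)]
  have Bb: "bilin_on S T U B" and Cb: "bilin_on S T U C"
    and Bo: "\<And>F G n m. F \<in> S \<Longrightarrow> G \<in> T \<Longrightarrow> vanishes n F \<Longrightarrow> vanishes m G \<Longrightarrow> vanishes (n + m) (B F G)"
    using B C by (auto simp: graded_bilin_def)
  \<comment> \<open>By \<open>derB\<close> the defect \<open>C\<close> is a combination of terms
    that each contain one order-raising operator, so it gains one order.\<close>
  have Co: "vanishes (Suc (n + m)) (C F G)"
    if "F \<in> S" "G \<in> T" "vanishes n F" "vanishes m G" for F G n m
  proof -
    have "C F G = L3 (B F G) + (-1) *\<^sub>R B (L1 F) G + (-1) *\<^sub>R B F (L2 G)"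
      using derB[OF that(1,2)] by simp
    moreover have "vanishes (Suc (n + m)) (L3 (B F G))"
      by (intro raising_vanishes[OF L3] bilin_on_closed[OF Bb] Bo that)
    moreover have "vanishes (Suc n + m) (B (L1 F) G)" "vanishes (n + Suc m) (B F (L2 G))"
      by (intro Bo that raising_vanishes[OF L1] raising_vanishes[OF L2] raising_closed[OF L1]
          raising_closed[OF L2])+
    ultimately show ?thesis
      by (auto simp: vanishes_def)
  qed
  define zB where "zB N = (\<Sum>n\<le>N. B (?x n) (?y (N - n)))" for N
  define zC where "zC N = (\<Sum>n\<le>N. C (?x n) (?y (N - n)))" for N
  have U: "zB N \<in> U" "zC N \<in> U" for N
    unfolding zB_def zC_def
    by (auto intro!: subspace_sum bilin_on_subspace(3)[OF Bb] bilin_on_closed[OF Bb] bilin_on_closed[OF Cb] x y)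
  have LB: "L3 (zB N) = real (Suc N) *\<^sub>R zB (Suc N) + zC N" for N
    unfolding zB_def zC_def by (rule leibniz_divpow[OF L1 L2 L3 Bb F(1) G(1) derB])
  have LC: "L3 (zC N) = real (Suc N) *\<^sub>R zC (Suc N)" for N
    using leibniz_divpow[OF L1 L2 L3 Cb F(1) G(1), of "\<lambda>F G. 0"] derC by (simp add: zC_def)
  have BFG: "B F G \<in> U" using F G by (intro bilin_on_closed[OF Bb])
  \<comment> \<open>As \<open>B\<close> has the defect \<open>C\<close> and \<open>C\<close> has
    none, each degree contains \<open>C\<close> at most once. In the induction step
    \<open>zC (Suc N)\<close> arises once from the defect of \<open>B\<close> and
    \<open>Suc N\<close> times from \<open>zC N\<close>, which gives the required factor
    \<open>Suc (Suc N)\<close>.\<close>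
  have z: "divpow L3 (B F G) (Suc N) = zB (Suc N) + zC N" for N
  proof (induction N)
    case 0
    have "L3 (B F G) = zB (Suc 0) + zC 0"
      using LB[of 0] by (simp add: zB_def[of 0])
    then show ?case by (simp add: divpow_def)
  next
    case (Suc N)
    have "real (Suc (Suc N)) *\<^sub>R divpow L3 (B F G) (Suc (Suc N)) = L3 (zB (Suc N) + zC N)"
      using divpow_Suc[OF L3 BFG, of "Suc N"] Suc by simp
    also have "\<dots> = real (Suc (Suc N)) *\<^sub>R (zB (Suc (Suc N)) + zC (Suc N))"
      by (simp add: raising_add[OF L3] U LB LC algebra_simps scaleR_2)
    finally show ?case by simp
  qed
  have "(\<Sum>N\<le>k. divpow L3 (B F G) N) = (\<Sum>N\<le>k. zB N) + (\<Sum>N<k. zC N)"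
  proof (induction k)
    case 0
    then show ?case by (simp add: zB_def)
  next
    case (Suc k)
    then show ?case by (simp add: z algebra_simps)
  qed
  \<comment> \<open>The sum of the \<open>zC\<close> stops below \<open>k\<close>; the missing term
    has order above \<open>k\<close>, so adding it does not alter the coefficient.\<close>
  moreover have "zC k $ k = 0"
    unfolding zC_def fps_sum_nth
  proof (intro sum.neutral ballI)
    fix n assume "n \<in> {..k}"
    moreover have "vanishes (Suc ((0 + n) + (0 + (k - n)))) (C (?x n) (?y (k - n)))"
      by (intro Co x y divpow_vanishes[OF L1 F(1)] divpow_vanishes[OF L2 G(1)]) auto
    ultimately show "C (?x n) (?y (k - n)) $ k = 0" by (simp add: vanishes_def)
  qed
  ultimately have lhs: "fexp L3 (B F G) $ k = (\<Sum>N\<le>k. zB N $ k) + (\<Sum>N\<le>k. zC N $ k)"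
    by (simp add: fexp_nth[OF L3 BFG order.refl] fps_sum_nth lessThan_Suc_atMost[symmetric])
  have expand: "H (fexp L1 F) (fexp L2 G) $ k = (\<Sum>N\<le>k. (\<Sum>n\<le>N. H (?x n) (?y (N - n))) $ k)"
    if H: "graded_bilin S T U H" for H
  proof -
    have Hb: "bilin_on S T U H"
      and Ho: "\<And>F G n m. F \<in> S \<Longrightarrow> G \<in> T \<Longrightarrow> vanishes n F \<Longrightarrow> vanishes m G \<Longrightarrow> vanishes (n + m) (H F G)"
      using H by (auto simp: graded_bilin_def)
    have "H (fexp L1 F) (fexp L2 G) $ k = H (\<Sum>n\<le>k. ?x n) (\<Sum>m\<le>k. ?y m) $ k"
      by (rule graded_bilin_cong[OF H F(2) divpow_sum_closed[OF L1 F(1)] G(2)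
            divpow_sum_closed[OF L2 G(1)] fexp_truncate[OF L1 F(1)] fexp_truncate[OF L2 G(1)]]) simp
    also have "\<dots> = (\<Sum>n\<le>k. \<Sum>m\<le>k. H (?x n) (?y m) $ k)"
      by (simp add: bilin_on_sum_left[OF Hb] bilin_on_sum_right[OF Hb] x y
          divpow_sum_closed[OF L2 G(1)] fps_sum_nth)
    also have "\<dots> = (\<Sum>N\<le>k. \<Sum>n\<le>N. H (?x n) (?y (N - n)) $ k)"
    proof (rule sum_square_triangle)
      fix n m :: nat assume "n + m > k"
      moreover have "vanishes ((0 + n) + (0 + m)) (H (?x n) (?y m))"
        by (intro Ho x y divpow_vanishes[OF L1 F(1)] divpow_vanishes[OF L2 G(1)]) auto
      ultimately show "H (?x n) (?y m) $ k = 0" by (simp add: vanishes_def)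
    qed
    finally show ?thesis by (simp add: fps_sum_nth)
  qed
  show "fexp L3 (B F G) $ k = (B (fexp L1 F) (fexp L2 G) + C (fexp L1 F) (fexp L2 G)) $ k"
    by (simp add: lhs expand[OF B] expand[OF C] zB_def zC_def)
qed

section \<open>Derivations of functions and vector fields\<close>

lemma smooth_mult:
  fixes f g :: "'a::euclidean_space \<Rightarrow> real"
  shows "smooth f \<Longrightarrow> smooth g \<Longrightarrow> smooth (\<lambda>x. f x * g x)"
  using smooth_scaleR[of f g] by simp

lemma subspace_Cinf: "subspace Cinf"
  by (auto simp: subspace_def Cinf_def plus_fun_def zero_fun_def scaleR_fun_def
      intro: smooth_add smooth_mult)

lemma subspace_VF: "subspace VF"
  by (auto simp: subspace_def VF_def plus_fun_def zero_fun_def scaleR_fun_def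
      intro: smooth_add smooth_scaleR)

lemma smooth_plus: "smooth f \<Longrightarrow> smooth g \<Longrightarrow> smooth (f + g)"
  by (simp add: plus_fun_def smooth_add)

lemma smooth_scale: "smooth f \<Longrightarrow> smooth (c *\<^sub>R f)"
  by (simp add: scaleR_fun_def smooth_scaleR)

lemma fd_plus: "smooth f \<Longrightarrow> smooth g \<Longrightarrow> fd (f + g) x v = fd f x v + fd g x v"
  by (simp add: plus_fun_def fd_add)

lemma fd_scale: "smooth f \<Longrightarrow> fd (c *\<^sub>R f) x v = c *\<^sub>R fd f x v"
  by (simp add: scaleR_fun_def fd_scaleR_const)

lemma bilin_vf_apply: "bilin_on VF Cinf Cinf vf_apply"
  unfolding bilin_on_def
  by (auto simp: subspace_Cinf[unfolded Cinf_def] subspace_VF[unfolded VF_def] Cinf_def VF_def vf_apply_def smooth_fd_app fun_eq_iff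
      fd_plus fd_scale linear_add[OF smooth_fd_linear] linear_cmul[OF smooth_fd_linear])

lemma bilin_times: "bilin_on Cinf Cinf Cinf (*)"
  unfolding bilin_on_def
  by (auto simp: subspace_Cinf[unfolded Cinf_def] Cinf_def times_fun_def fun_eq_iff algebra_simps
      intro: smooth_mult)

lemma bilin_trivial_connection: "bilin_on VF VF VF trivial_connection"
  unfolding bilin_on_def
  by (auto simp: subspace_VF[unfolded VF_def] VF_def trivial_connection_def smooth_fd_app fun_eq_iff
      fd_plus fd_scale linear_add[OF smooth_fd_linear] linear_cmul[OF smooth_fd_linear])

lemma bilin_lie_bracket: "bilin_on VF VF VF lie_bracket"
  unfolding bilin_on_def
  by (auto simp: subspace_VF[unfolded VF_def] VF_def lie_bracket_def smooth_fd_app smooth_diff fun_eq_iff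
      fd_plus fd_scale linear_add[OF smooth_fd_linear] linear_cmul[OF smooth_fd_linear]
      algebra_simps)

text \<open>The second derivatives of \<open>f\<close> cancel by symmetry. Read as a Leibniz rule,
  the identity shows that the bracket is the action on fields that goes with derivation of
  functions.\<close>

lemma vf_apply_commutator:
  assumes "e \<in> VF" "X \<in> VF" "f \<in> Cinf"
  shows "vf_apply e (vf_apply X f) = vf_apply (lie_bracket e X) f + vf_apply X (vf_apply e f)"
proof
  fix x
  have s: "smooth e" "smooth X" "smooth f" using assms by (auto simp: VF_def Cinf_def)
  show "vf_apply e (vf_apply X f) x = (vf_apply (lie_bracket e X) f + vf_apply X (vf_apply e f)) x"
    using fd_fd_sym[OF s(3), of "X x" x "e x"]
    by (simp add: vf_apply_def lie_bracket_def fd_fd_app[OF s(3) s(1)] fd_fd_app[OF s(3) s(2)] s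
        linear_diff[OF smooth_fd_linear])
qed

lemma vf_apply_times:
  assumes "e \<in> VF" "f \<in> Cinf" "g \<in> Cinf"
  shows "vf_apply e (f * g) = vf_apply e f * g + f * vf_apply e g"
  using assms by (auto simp: vf_apply_def fun_eq_iff times_fun_def fd_mult Cinf_def)

text \<open>The last summand is the Lie derivative of the trivial connection along \<open>e\<close>.\<close>

lemma lie_bracket_trivial_connection:
  assumes "e \<in> VF" "X \<in> VF" "Y \<in> VF"
  shows "lie_bracket e (trivial_connection X Y) =
    trivial_connection (lie_bracket e X) Y + trivial_connection X (lie_bracket e Y)
      + (\<lambda>x. fd (\<lambda>y. fd e y (Y x)) x (X x))"
proof
  fix x
  have s: "smooth e" "smooth X" "smooth Y" using assms by (auto simp: VF_def)
  show "lie_bracket e (trivial_connection X Y) x =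
    (trivial_connection (lie_bracket e X) Y + trivial_connection X (lie_bracket e Y)
      + (\<lambda>x. fd (\<lambda>y. fd e y (Y x)) x (X x))) x"
    using fd_fd_sym[OF s(3), of "X x" x "e x"]
    by (simp add: trivial_connection_def lie_bracket_def fd_fd_app[OF s(3) s(1)]
        fd_fd_app[OF s(3) s(2)] fd_fd_app[OF s(1) s(3)] fd_diff smooth_fd_app s
        linear_diff[OF smooth_fd_linear])
qed

section \<open>Hamiltonian vector fields and infinitesimal symplectic symmetries\<close>

context
  fixes \<Omega> :: "real ^ 'm \<Rightarrow> real ^ 'm \<Rightarrow> real"
  assumes \<Omega>: "symplectic_form \<Omega>"
begin

lemma symplectic_bilinear: "bilinear \<Omega>"
  using \<Omega> by (simp add: symplectic_form_def)

lemma symplectic_skew: "\<Omega> v w = - \<Omega> w v"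
  using \<Omega> unfolding symplectic_form_def by blast

lemma symplectic_add_left: "\<Omega> (u + v) w = \<Omega> u w + \<Omega> v w"
  using symplectic_bilinear by (rule bilinear_ladd)

lemma symplectic_diff_left: "\<Omega> (u - v) w = \<Omega> u w - \<Omega> v w"
  using symplectic_bilinear by (rule bilinear_lsub)

lemma symplectic_scale_left: "\<Omega> (c *\<^sub>R u) w = c * \<Omega> u w"
  using bilinear_lmul[OF symplectic_bilinear] by simp

lemma symplectic_nondegenerate: "(\<And>w. \<Omega> v w = \<Omega> v' w) \<Longrightarrow> v = v'"
  using \<Omega> symplectic_diff_left[of v v'] unfolding symplectic_form_def
  by (metis eq_iff_diff_eq_0)

text \<open>Nondegeneracy makes the map \<open>T\<close>, which represents \<open>\<Omega> v\<close>
  through the inner product, injective, hence invertible in finite dimension; \<open>J\<close>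
  inverts it.\<close>

lemma symplectic_dual:
  obtains J where "linear J" "\<And>\<xi> w. \<Omega> (J \<xi>) w = \<xi> \<bullet> w"
proof -
  define T where "T v = (\<Sum>b\<in>Basis. \<Omega> v b *\<^sub>R b)" for v
  have lin: "linear (\<lambda>w. \<Omega> v w)" for v
    using symplectic_bilinear by (simp add: bilinear_def)
  have Tw: "T v \<bullet> w = \<Omega> v w" for v w
  proof -
    have "\<Omega> v w = \<Omega> v (\<Sum>b\<in>Basis. (w \<bullet> b) *\<^sub>R b)" by (simp add: euclidean_representation)
    also have "\<dots> = (\<Sum>b\<in>Basis. (w \<bullet> b) * \<Omega> v b)"
      by (simp add: linear_sum[OF lin] linear_cmul[OF lin])
    also have "\<dots> = T v \<bullet> w"
      by (simp add: T_def inner_sum_left inner_commute[of w] mult.commute)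
    finally show ?thesis by simp
  qed
  have "linear T"
    by (rule linearI)
      (simp_all add: T_def symplectic_add_left symplectic_scale_left scaleR_add_left sum.distrib
        scaleR_right.sum)
  moreover have "inj T"
    by (rule injI) (metis Tw symplectic_nondegenerate)
  ultimately obtain J where "linear J" "\<And>\<xi>. T (J \<xi>) = \<xi>"
    using linear_injective_isomorphism[of T] by auto
  with that show ?thesis by (metis Tw)
qed

text \<open>The explicit field \<open>h\<close>, obtained by applying \<open>J\<close> to the
  gradient, satisfies the definite description and displays its smoothness.\<close>

lemma ham_vf_props:
  assumes f: "smooth f"
  shows ham_vf_apply: "\<Omega> (ham_vf \<Omega> f x) w = fd f x w"
    and smooth_ham_vf: "smooth (ham_vf \<Omega> f)"
proof -
  obtain J where J: "linear J" "\<And>\<xi> w. \<Omega> (J \<xi>) w = \<xi> \<bullet> w" by (rule symplectic_dual) blast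
  define h where "h x = (\<Sum>b\<in>Basis. fd f x b *\<^sub>R J b)" for x
  have h: "\<Omega> (h x) w = fd f x w" for x w
  proof -
    have "h x = J (\<Sum>b\<in>Basis. fd f x b *\<^sub>R b)"
      by (simp add: h_def linear_sum[OF J(1)] linear_cmul[OF J(1)])
    then have "\<Omega> (h x) w = (\<Sum>b\<in>Basis. (w \<bullet> b) *\<^sub>R fd f x b)"
      by (simp add: J(2) inner_sum_left inner_commute[of w] mult.commute)
    then show ?thesis using fd_expand[OF f, of x w] by simp
  qed
  have eq: "ham_vf \<Omega> f = h"
  proof
    fix x
    show "ham_vf \<Omega> f x = h x"
      unfolding ham_vf_def using h by (intro the_equality) (auto intro: symplectic_nondegenerate)
  qed
  show "\<Omega> (ham_vf \<Omega> f x) w = fd f x w" by (simp add: eq h)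
  show "smooth (ham_vf \<Omega> f)"
    unfolding eq h_def by (intro smooth_sum smooth_scaleR smooth_fd f smooth_const)
qed

lemma ham_vf_unique: "smooth f \<Longrightarrow> (\<And>w. \<Omega> v w = fd f x w) \<Longrightarrow> ham_vf \<Omega> f x = v"
  by (rule symplectic_nondegenerate) (simp add: ham_vf_apply)

lemma poisson_eq: "smooth f \<Longrightarrow> poisson \<Omega> f g = - vf_apply (ham_vf \<Omega> g) f"
  by (simp add: poisson_def vf_pair_def vf_apply_def ham_vf_apply)

lemma bilin_poisson: "bilin_on Cinf Cinf Cinf (poisson \<Omega>)"
proof -
  have V: "ham_vf \<Omega> g \<in> VF" if "g \<in> Cinf" for g
    using that by (simp add: VF_def Cinf_def smooth_ham_vf)
  have P: "poisson \<Omega> f g = - vf_apply (ham_vf \<Omega> g) f" if "f \<in> Cinf" for f g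
    using that by (simp add: Cinf_def poisson_eq)
  have "ham_vf \<Omega> (g + g') = ham_vf \<Omega> g + ham_vf \<Omega> g'" if "g \<in> Cinf" "g' \<in> Cinf" for g g'
    using that
    by (intro ext ham_vf_unique)
      (auto simp: Cinf_def symplectic_add_left ham_vf_apply fd_plus smooth_plus)
  moreover have "ham_vf \<Omega> (c *\<^sub>R g) = c *\<^sub>R ham_vf \<Omega> g" if "g \<in> Cinf" for c g
    using that
    by (intro ext ham_vf_unique)
      (auto simp: Cinf_def symplectic_scale_left ham_vf_apply fd_scale smooth_scale)
  ultimately show ?thesis
    unfolding bilin_on_def
    using bilin_on_closed[OF bilin_vf_apply V] bilin_on_add_left[OF bilin_vf_apply V V]
      bilin_on_add_right[OF bilin_vf_apply V] bilin_on_scale_left[OF bilin_vf_apply V]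
      bilin_on_scale_right[OF bilin_vf_apply V] subspace_Cinf
    by (auto simp: P subspace_neg subspace_add subspace_scale)
qed

text \<open>Pair the bracket with a constant vector \<open>w\<close>. The derivative of the
  Hamiltonian field contributes the second derivative of \<open>g\<close>; in the other term
  \<open>sp\<close> moves \<open>fd e x\<close> onto \<open>w\<close>, giving the remaining term of
  the product rule for \<open>vf_apply e g\<close>.\<close>

lemma ham_vf_vf_apply:
  assumes e: "smooth e" and g: "smooth g"
    and sp: "\<And>x v w. \<Omega> (fd e x v) w = - \<Omega> v (fd e x w)"
  shows "ham_vf \<Omega> (vf_apply e g) = lie_bracket e (ham_vf \<Omega> g)"
proof (intro ext ham_vf_unique)
  show "smooth (vf_apply e g)"
    unfolding vf_apply_def by (rule smooth_fd_app[OF g e])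
  fix x w
  have "\<Omega> (fd (ham_vf \<Omega> g) x (e x)) w = fd (\<lambda>y. \<Omega> (ham_vf \<Omega> g y) w) x (e x)"
    using fd_bilinear[OF symplectic_bilinear smooth_ham_vf[OF g] smooth_const]
      bilinear_rzero[OF symplectic_bilinear] by simp
  also have "\<dots> = fd (\<lambda>y. fd g y w) x (e x)"
    by (simp add: ham_vf_apply g)
  finally show "\<Omega> (lie_bracket e (ham_vf \<Omega> g) x) w = fd (vf_apply e g) x w"
    using fd_fd_sym[OF g, of w x "e x"]
    by (simp add: lie_bracket_def vf_apply_def symplectic_diff_left sp ham_vf_apply g fd_fd_app[OF g e])
qed

text \<open>The bracket of \<open>f\<close> and \<open>g\<close> is minus the derivative of
  \<open>f\<close> along the Hamiltonian field of \<open>g\<close>. The commutator rule applies to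
  it, and the bracket of \<open>e\<close> with this field is again Hamiltonian.\<close>

lemma vf_apply_poisson:
  assumes e: "e \<in> VF" and f: "f \<in> Cinf" and g: "g \<in> Cinf"
    and sp: "\<And>x v w. \<Omega> (fd e x v) w = - \<Omega> v (fd e x w)"
  shows "vf_apply e (poisson \<Omega> f g) = poisson \<Omega> (vf_apply e f) g + poisson \<Omega> f (vf_apply e g)"
proof -
  have s: "smooth e" "smooth f" "smooth g" using e f g by (auto simp: VF_def Cinf_def)
  have h: "ham_vf \<Omega> g \<in> VF" using s by (simp add: VF_def smooth_ham_vf)
  have ef: "smooth (vf_apply e f)"
    using bilin_on_closed[OF bilin_vf_apply e f] by (simp add: Cinf_def)
  have "vf_apply e (poisson \<Omega> f g) = - vf_apply e (vf_apply (ham_vf \<Omega> g) f)"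
    using bilin_on_scale_right[OF bilin_vf_apply e, of "vf_apply (ham_vf \<Omega> g) f" "-1"]
      bilin_on_closed[OF bilin_vf_apply h f] by (simp add: poisson_eq s)
  then show ?thesis
    by (simp add: vf_apply_commutator[OF e h f] poisson_eq s ef ham_vf_vf_apply[OF s(1,3) sp])
qed

end

section \<open>Derivations of formal power series\<close>

lemma fps_times_conv_bilin: "F * G = fps_bilin (*) F G"
  by (simp add: fps_eq_iff fps_mult_nth fps_bilin_nth atLeast0AtMost)

lemma times_formal: "F \<in> formal Cinf \<Longrightarrow> G \<in> formal Cinf \<Longrightarrow> F * G \<in> formal Cinf"
  unfolding fps_times_conv_bilin by (rule bilin_on_closed[OF fps_bilin_bilin[OF bilin_times]])

lemma vf_formal: "X \<in> formal VF \<Longrightarrow> F \<in> formal Cinf \<Longrightarrow> fps_bilin vf_apply X F \<in> formal Cinf"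
  by (rule bilin_on_closed[OF fps_bilin_bilin[OF bilin_vf_apply]])

lemma const_Cinf: "(\<lambda>x. c) \<in> Cinf" "1 \<in> Cinf" "0 \<in> Cinf"
  by (simp_all add: Cinf_def one_fun_def zero_fun_def)

lemma fps_const_formal: "f \<in> S \<Longrightarrow> 0 \<in> S \<Longrightarrow> fps_const f \<in> formal S"
  by (auto intro: formalI)

lemma fps_X_formal: "fps_X \<in> formal Cinf"
  by (rule formalI) (simp add: fps_X_def const_Cinf)

lemma vf_apply_const: "vf_apply X (\<lambda>x. c) = 0" "vf_apply X 0 = 0" "vf_apply X 1 = 0"
  by (simp_all add: vf_apply_def fun_eq_iff zero_fun_def one_fun_def)

lemma fps_bilin_vf_apply_const:
  "fps_bilin vf_apply Y (fps_const f) = Abs_fps (\<lambda>k. vf_apply (Y $ k) f)"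
proof (rule fps_ext)
  fix k
  have "fps_bilin vf_apply Y (fps_const f) $ k
      = (\<Sum>i\<in>{..k}. vf_apply (Y $ i) (if k - i = 0 then f else 0))"
    by (simp add: fps_bilin_nth)
  also have "\<dots> = (\<Sum>i\<in>{k}. vf_apply (Y $ i) (if k - i = 0 then f else 0))"
    by (intro sum.mono_neutral_right) (auto simp: vf_apply_const)
  finally show "fps_bilin vf_apply Y (fps_const f) $ k = Abs_fps (\<lambda>k. vf_apply (Y $ k) f) $ k"
    by simp
qed

text \<open>Constant series of linear coordinate functions already detect every component. This
  gives the uniqueness needed for the definite description of the push-forward.\<close>

lemma formal_vf_eqI:
  assumes "\<And>F. F \<in> formal Cinf \<Longrightarrow> fps_bilin vf_apply Y F = fps_bilin vf_apply Y' F"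
  shows "Y = Y'"
proof (rule fps_ext, rule ext)
  fix k x
  show "(Y $ k) x = (Y' $ k) x"
  proof (rule euclidean_eqI)
    fix b :: "real ^ 'a"
    have l: "linear (\<lambda>x::real ^ 'a. x \<bullet> b)"
      by (rule bounded_linear.linear[OF bounded_linear_inner_left])
    have s: "smooth (\<lambda>x. x \<bullet> b)" using smooth_linear[OF l smooth_ident] .
    have d: "fd (\<lambda>x. x \<bullet> b) x v = v \<bullet> b" for v
      using fdI[OF bounded_linear_imp_has_derivative[OF bounded_linear_inner_left]] by metis
    have "fps_const (\<lambda>x. x \<bullet> b) \<in> formal Cinf"
      using s const_Cinf by (intro fps_const_formal) (auto simp: Cinf_def)
    from assms[OF this] have "vf_apply (Y $ k) (\<lambda>x. x \<bullet> b) = vf_apply (Y' $ k) (\<lambda>x. x \<bullet> b)"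
      by (simp add: fps_bilin_vf_apply_const fps_eq_iff)
    from fun_cong[OF this, of x] show "(Y $ k) x \<bullet> b = (Y' $ k) x \<bullet> b"
      by (simp add: vf_apply_def d)
  qed
qed

text \<open>Both sides run over triples of indices with sum \<open>k\<close>, grouped once by the
  sum of the first two and once by the first.\<close>

lemma sum_reindex_add:
  fixes f :: "nat \<Rightarrow> nat \<Rightarrow> nat \<Rightarrow> 'a::comm_monoid_add"
  shows "(\<Sum>m\<le>k. \<Sum>i\<le>m. f i (m - i) (k - m)) = (\<Sum>i\<le>k. \<Sum>j\<le>k - i. f i j (k - i - j))"
  unfolding sum.Sigma[OF finite_atMost ballI[OF finite_atMost]]
  by (rule sum.reindex_bij_witness[of _ "\<lambda>(i, j). (i + j, i)" "\<lambda>(m, i). (i, m - i)"]) auto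

lemma sum_reindex_swap:
  fixes f :: "nat \<Rightarrow> nat \<Rightarrow> nat \<Rightarrow> 'a::comm_monoid_add"
  shows "(\<Sum>j\<le>k. \<Sum>i\<le>k - j. f i j (k - j - i)) = (\<Sum>i\<le>k. \<Sum>j\<le>k - i. f i j (k - i - j))"
  unfolding sum.Sigma[OF finite_atMost ballI[OF finite_atMost]]
  by (rule sum.reindex_bij_witness[of _ "\<lambda>(i, j). (j, i)" "\<lambda>(j, i). (i, j)"]) (auto simp: add.commute)

definition fps_trilin :: "('a \<Rightarrow> 'b \<Rightarrow> 'c \<Rightarrow> 'd::comm_monoid_add) \<Rightarrow> 'a fps \<Rightarrow> 'b fps \<Rightarrow> 'c fps \<Rightarrow> 'd fps" where
  "fps_trilin H E X Y = Abs_fps (\<lambda>k. \<Sum>i\<le>k. fps_bilin (H (E $ i)) X Y $ (k - i))"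

text \<open>Every term is a sum over triples of coefficients with total degree \<open>k\<close>, so
  the rule for single coefficients passes to series after regrouping.\<close>

lemma fps_bilin_leibniz:
  assumes B3: "bilin_on S U U \<beta>3" and B: "bilin_on T1 T2 U B"
    and B1: "bilin_on S T1 T1 \<beta>1" and B2: "bilin_on S T2 T2 \<beta>2"
    and E: "E \<in> formal S" and X: "X \<in> formal T1" and Y: "Y \<in> formal T2"
    and der: "\<And>i x y. x \<in> T1 \<Longrightarrow> y \<in> T2 \<Longrightarrow>
      \<beta>3 (E $ i) (B x y) = B (\<beta>1 (E $ i) x) y + B x (\<beta>2 (E $ i) y) + H (E $ i) x y"
  shows "fps_bilin \<beta>3 E (fps_bilin B X Y) =
    fps_bilin B (fps_bilin \<beta>1 E X) Y + fps_bilin B X (fps_bilin \<beta>2 E Y) + fps_trilin H E X Y"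
proof (rule fps_ext)
  fix k
  note mem = formal_nth[OF E] formal_nth[OF X] formal_nth[OF Y]
  have "fps_bilin \<beta>3 E (fps_bilin B X Y) $ k =
      (\<Sum>i\<le>k. \<Sum>j\<le>k - i. \<beta>3 (E $ i) (B (X $ j) (Y $ (k - i - j))))"
    by (simp add: fps_bilin_nth bilin_on_sum_right[OF B3] bilin_on_closed[OF B] mem)
  also have "\<dots> = (\<Sum>i\<le>k. \<Sum>j\<le>k - i. B (\<beta>1 (E $ i) (X $ j)) (Y $ (k - i - j)))
      + (\<Sum>i\<le>k. \<Sum>j\<le>k - i. B (X $ j) (\<beta>2 (E $ i) (Y $ (k - i - j))))
      + (\<Sum>i\<le>k. \<Sum>j\<le>k - i. H (E $ i) (X $ j) (Y $ (k - i - j)))"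
    by (simp add: der mem sum.distrib)
  also have "(\<Sum>i\<le>k. \<Sum>j\<le>k - i. B (\<beta>1 (E $ i) (X $ j)) (Y $ (k - i - j)))
      = fps_bilin B (fps_bilin \<beta>1 E X) Y $ k"
    by (subst sum_reindex_add[symmetric])
      (simp add: fps_bilin_nth bilin_on_sum_left[OF B] bilin_on_closed[OF B1] mem)
  also have "(\<Sum>i\<le>k. \<Sum>j\<le>k - i. B (X $ j) (\<beta>2 (E $ i) (Y $ (k - i - j))))
      = fps_bilin B X (fps_bilin \<beta>2 E Y) $ k"
    by (subst sum_reindex_swap[symmetric])
      (simp add: fps_bilin_nth bilin_on_sum_right[OF B] bilin_on_closed[OF B2] mem)
  also have "(\<Sum>i\<le>k. \<Sum>j\<le>k - i. H (E $ i) (X $ j) (Y $ (k - i - j))) = fps_trilin H E X Y $ k"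
    by (simp add: fps_trilin_def fps_bilin_nth)
  finally show "fps_bilin \<beta>3 E (fps_bilin B X Y) $ k =
    (fps_bilin B (fps_bilin \<beta>1 E X) Y + fps_bilin B X (fps_bilin \<beta>2 E Y) + fps_trilin H E X Y) $ k"
    by simp
qed

lemma fps_bilin_derivation:
  assumes "bilin_on S U U \<beta>3" "bilin_on T1 T2 U B" "bilin_on S T1 T1 \<beta>1" "bilin_on S T2 T2 \<beta>2"
    "E \<in> formal S" "X \<in> formal T1" "Y \<in> formal T2"
    and "\<And>i x y. x \<in> T1 \<Longrightarrow> y \<in> T2 \<Longrightarrow>
      \<beta>3 (E $ i) (B x y) = B (\<beta>1 (E $ i) x) y + B x (\<beta>2 (E $ i) y)"
  shows "fps_bilin \<beta>3 E (fps_bilin B X Y) =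
    fps_bilin B (fps_bilin \<beta>1 E X) Y + fps_bilin B X (fps_bilin \<beta>2 E Y)"
proof -
  have "fps_trilin (\<lambda>_ _ _. 0) E X Y = 0"
    by (simp add: fps_trilin_def fps_bilin_nth fps_eq_iff)
  with fps_bilin_leibniz[OF assms(1-7), of "\<lambda>_ _ _. 0"] assms(8) show ?thesis by simp
qed

lemma fexp_hom:
  assumes "raising (formal S) L1" "raising (formal T) L2" "raising (formal U) L3"
    and "subspace S" "subspace T" "graded_bilin (formal S) (formal T) (formal U) B"
    and "F \<in> formal S" "G \<in> formal T"
    and "\<And>F G. F \<in> formal S \<Longrightarrow> G \<in> formal T \<Longrightarrow> L3 (B F G) = B (L1 F) G + B F (L2 G)"
  shows "fexp L3 (B F G) = B (fexp L1 F) (fexp L2 G)"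
proof -
  have "graded_bilin (formal S) (formal T) (formal U) (\<lambda>F G. 0)"
    using assms(6) by (auto simp: graded_bilin_def bilin_on_def vanishes_def subspace_0)
  from fexp_leibniz[OF assms(1-3,6) this assms(7) fexp_closed[OF assms(1,4,7)]
      assms(8) fexp_closed[OF assms(2,5,8)]]
  show ?thesis using assms(9) raising_zero[OF assms(3)] by simp
qed

lemma fexp_bij:
  assumes "raising (formal S) L" "subspace S"
  shows "bij_betw (fexp L) (formal S) (formal S)"
  by (rule bij_betw_byWitness[of _ "fexp (\<lambda>F. - L F)"])
    (use fexp_uminus_inverse[OF assms] fexp_uminus_inverse'[OF assms] fexp_closed[OF assms]
      fexp_closed[OF raising_uminus[OF assms(1)] assms(2)] in auto)

lemma fexp_leading:
  assumes L: "raising S L" and F: "F \<in> S" "vanishes n F"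
  shows "fexp L F $ n = F $ n"
proof -
  have "divpow L F i $ n = 0" if "i > 0" for i
    using divpow_vanishes[OF L F, of i] that by (simp add: vanishes_def)
  then have "(\<Sum>i\<le>n. divpow L F i $ n) = (\<Sum>i\<in>{0}. divpow L F i $ n)"
    by (intro sum.mono_neutral_right) auto
  then show ?thesis by (simp add: fexp_def)
qed

section \<open>Formal automorphisms and their action on connections\<close>

text \<open>Here \<open>p\<close> is the action of \<open>P\<close> on formal vector fields; the last clause says that \<open>P\<close> is the
  identity to leading order in the formal parameter, which makes \<open>P\<close> continuous.\<close>

definition formal_auto ::
    "(real ^ 'm \<Rightarrow> real ^ 'm \<Rightarrow> real) \<Rightarrow> ('m fn fps \<Rightarrow> 'm fn fps) \<Rightarrow> ('m vfield fps \<Rightarrow> 'm vfield fps) \<Rightarrow> bool"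
  where "formal_auto \<Omega> P p \<longleftrightarrow>
    bij_betw P (formal Cinf) (formal Cinf) \<and> bij_betw p (formal VF) (formal VF) \<and>
    (\<forall>F\<in>formal Cinf. \<forall>G\<in>formal Cinf. P (F + G) = P F + P G) \<and>
    (\<forall>F\<in>formal Cinf. \<forall>G\<in>formal Cinf. P (F * G) = P F * P G) \<and>
    (\<forall>F\<in>formal Cinf. \<forall>G\<in>formal Cinf.
      P (fps_bilin (poisson \<Omega>) F G) = fps_bilin (poisson \<Omega>) (P F) (P G)) \<and>
    (\<forall>X\<in>formal VF. \<forall>F\<in>formal Cinf.
      P (fps_bilin vf_apply X F) = fps_bilin vf_apply (p X) (P F)) \<and>
    (\<forall>c. P (fps_const (\<lambda>_. c)) = fps_const (\<lambda>_. c)) \<and> P fps_X = fps_X \<and>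
    (\<forall>n. \<forall>F\<in>formal Cinf. vanishes n F \<longrightarrow> P F $ n = F $ n)"

lemma poisson_formal:
  assumes "symplectic_form \<Omega>" "F \<in> formal Cinf" "G \<in> formal Cinf"
  shows "fps_bilin (poisson \<Omega>) F G \<in> formal Cinf"
  by (rule bilin_on_closed[OF fps_bilin_bilin[OF bilin_poisson[OF assms(1)]] assms(2,3)])

text \<open>Each algebraic clause is a Leibniz rule for the coefficients of \<open>E\<close>,
  exponentiated. That these coefficients are infinitesimally symplectic, \<open>sp\<close>, enters
  through the Poisson bracket.\<close>

lemma formal_auto_fexp:
  assumes \<Omega>: "symplectic_form \<Omega>" and E: "E \<in> formal VF" "E $ 0 = 0"
    and sp: "\<And>k x v w. \<Omega> (fd (E $ k) x v) w = - \<Omega> v (fd (E $ k) x w)"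
  shows "formal_auto \<Omega> (fexp (fps_bilin vf_apply E)) (fexp (fps_bilin lie_bracket E))"
proof -
  let ?L = "fps_bilin vf_apply E" and ?l = "fps_bilin lie_bracket E"
  have L: "raising (formal Cinf) ?L" by (rule raising_fps_bilin[OF bilin_vf_apply E])
  have l: "raising (formal VF) ?l" by (rule raising_fps_bilin[OF bilin_lie_bracket E])
  have Ek: "E $ k \<in> VF" for k using E(1) by (rule formal_nth)
  have "fexp ?L (F * G) = fexp ?L F * fexp ?L G" if "F \<in> formal Cinf" "G \<in> formal Cinf" for F G
    unfolding fps_times_conv_bilin
    by (rule fexp_hom[OF L L L subspace_Cinf subspace_Cinf fps_bilin_graded[OF bilin_times] that],
        rule fps_bilin_derivation[OF bilin_vf_apply bilin_times bilin_vf_apply bilin_vf_apply E(1)])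
      (auto intro: vf_apply_times[OF Ek])
  moreover have "fexp ?L (fps_bilin (poisson \<Omega>) F G) = fps_bilin (poisson \<Omega>) (fexp ?L F) (fexp ?L G)"
    if "F \<in> formal Cinf" "G \<in> formal Cinf" for F G
    by (rule fexp_hom[OF L L L subspace_Cinf subspace_Cinf fps_bilin_graded[OF bilin_poisson[OF \<Omega>]] that],
        rule fps_bilin_derivation[OF bilin_vf_apply bilin_poisson[OF \<Omega>] bilin_vf_apply bilin_vf_apply E(1)])
      (auto intro: vf_apply_poisson[OF \<Omega> Ek _ _ sp])
  moreover have "fexp ?L (fps_bilin vf_apply X F) = fps_bilin vf_apply (fexp ?l X) (fexp ?L F)"
    if "X \<in> formal VF" "F \<in> formal Cinf" for X F
    by (rule fexp_hom[OF l L L subspace_VF subspace_Cinf fps_bilin_graded[OF bilin_vf_apply] that],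
        rule fps_bilin_derivation[OF bilin_vf_apply bilin_vf_apply bilin_lie_bracket bilin_vf_apply E(1)])
      (auto intro: vf_apply_commutator[OF Ek])
  moreover have "fexp ?L (fps_const (\<lambda>_. c)) = fps_const (\<lambda>_. c)" for c
    by (rule fexp_fixed[OF L]) (simp add: fps_bilin_vf_apply_const vf_apply_const fps_eq_iff)
  moreover have "fexp ?L fps_X = fps_X"
    by (rule fexp_fixed[OF L])
      (auto simp: fps_eq_iff fps_bilin_nth fps_X_def vf_apply_const intro!: sum.neutral)
  ultimately show ?thesis
    using fexp_bij[OF L subspace_Cinf] fexp_bij[OF l subspace_VF] fexp_add[OF L] fexp_leading[OF L]
    by (auto simp: formal_auto_def)
qed

text \<open>Three separate bijections make room for the mixed case in which fields act on
  functions.\<close>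

lemma inv_into_hom2:
  assumes "bij_betw f A A" "bij_betw g B B" "bij_betw h C C"
    and "\<And>x y. x \<in> A \<Longrightarrow> y \<in> B \<Longrightarrow> M x y \<in> C"
    and "\<And>x y. x \<in> A \<Longrightarrow> y \<in> B \<Longrightarrow> h (M x y) = M (f x) (g y)"
    and "x \<in> A" "y \<in> B"
  shows "inv_into C h (M x y) = M (inv_into A f x) (inv_into B g y)"
proof -
  have "inv_into A f x \<in> A" "inv_into B g y \<in> B" "f (inv_into A f x) = x" "g (inv_into B g y) = y"
    using assms by (auto simp: bij_betw_def inv_into_into f_inv_into_f)
  with assms show ?thesis
    by (intro inv_into_f_eq) (auto simp: bij_betw_def)
qed

lemma formal_auto_inv:
  assumes \<Omega>: "symplectic_form \<Omega>" and P: "formal_auto \<Omega> P p"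
  shows "formal_auto \<Omega> (inv_into (formal Cinf) P) (inv_into (formal VF) p)"
proof -
  let ?Q = "inv_into (formal Cinf) P"
  have b: "bij_betw P (formal Cinf) (formal Cinf)" and b': "bij_betw p (formal VF) (formal VF)"
    using P by (auto simp: formal_auto_def)
  note hom = inv_into_hom2[OF b b b] and homX = inv_into_hom2[OF b' b b]
  have fixed: "?Q F = F" if "F \<in> formal Cinf" "P F = F" for F
    using that b by (metis bij_betw_inv_into_left)
  have lead: "?Q F $ n = F $ n" if F: "F \<in> formal Cinf" and n: "vanishes n F" for F n
  proof -
    define G where "G = ?Q F"
    have G: "G \<in> formal Cinf" "P G = F"
      using b F by (auto simp: G_def bij_betw_def inv_into_into f_inv_into_f)
    \<comment> \<open>Strong induction on \<open>i\<close>: once the lower coefficients of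
      \<open>G\<close> are known to vanish, \<open>P\<close> fixes the coefficient at
      \<open>i\<close>, so \<open>G\<close> and \<open>F\<close> agree there.\<close>
    have "vanishes i G \<and> G $ i = F $ i" if "i \<le> n" for i
      using that
    proof (induction i rule: less_induct)
      case (less i)
      have "vanishes i G"
        using less n by (auto simp: vanishes_def)
      then have "P G $ i = G $ i"
        using P G(1) by (auto simp: formal_auto_def)
      with \<open>vanishes i G\<close> G(2) show ?case by simp
    qed
    then show ?thesis by (simp add: G_def)
  qed
  have "?Q (F + G) = ?Q F + ?Q G" if "F \<in> formal Cinf" "G \<in> formal Cinf" for F G
    using that P
    by (intro hom) (auto simp: formal_auto_def subspace_add[OF subspace_formal[OF subspace_Cinf]])
  moreover have "?Q (F * G) = ?Q F * ?Q G" if "F \<in> formal Cinf" "G \<in> formal Cinf" for F G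
    using that P by (intro hom) (auto simp: formal_auto_def times_formal)
  moreover have "?Q (fps_bilin (poisson \<Omega>) F G) = fps_bilin (poisson \<Omega>) (?Q F) (?Q G)"
    if "F \<in> formal Cinf" "G \<in> formal Cinf" for F G
    using that P by (intro hom) (auto simp: formal_auto_def poisson_formal[OF \<Omega>])
  moreover have "?Q (fps_bilin vf_apply X F) = fps_bilin vf_apply (inv_into (formal VF) p X) (?Q F)"
    if "X \<in> formal VF" "F \<in> formal Cinf" for X F
    using that P by (intro homX) (auto simp: formal_auto_def vf_formal)
  moreover have "?Q (fps_const (\<lambda>_. c)) = fps_const (\<lambda>_. c)" "?Q fps_X = fps_X" for c
    using P by (auto intro!: fixed fps_const_formal fps_X_formal const_Cinf simp: formal_auto_def)
  ultimately show ?thesis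
    unfolding formal_auto_def
    using bij_betw_inv_into[OF b] bij_betw_inv_into[OF b'] lead by simp
qed

lemma formal_auto_closed:
  assumes "formal_auto \<Omega> P p"
  shows "F \<in> formal Cinf \<Longrightarrow> P F \<in> formal Cinf" "X \<in> formal VF \<Longrightarrow> p X \<in> formal VF"
  using assms by (auto simp: formal_auto_def bij_betw_def)

lemma formal_auto_vanishes:
  assumes "formal_auto \<Omega> P p" "F \<in> formal Cinf" "vanishes n F" "i < n"
  shows "P F $ i = 0"
proof -
  have "vanishes i F" "F $ i = 0" using assms(3,4) by (auto simp: vanishes_def)
  then show ?thesis using assms(1,2) by (auto simp: formal_auto_def)
qed

lemma formal_auto_comp:
  assumes P: "formal_auto \<Omega> P p" and P': "formal_auto \<Omega> P' p'"
  shows "formal_auto \<Omega> (P' \<circ> P) (p' \<circ> p)"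
proof -
  have "(P' \<circ> P) F $ n = F $ n" if "F \<in> formal Cinf" "vanishes n F" for n F
  proof -
    have "vanishes n (P F)"
      using formal_auto_vanishes[OF P that] by (simp add: vanishes_def)
    then show ?thesis
      using that P P' formal_auto_closed[OF P] by (simp add: formal_auto_def)
  qed
  then show ?thesis
    using P P' formal_auto_closed[OF P]
    unfolding formal_auto_def comp_def[symmetric]
    by (auto intro: bij_betw_trans)
qed

text \<open>\<open>K\<close> is additive, multiplicative and fixes \<open>fps_X\<close>, so on
  polynomials in the parameter it is determined by its values on constant series. Preservation of
  order disposes of the remainder of the series.\<close>

lemma fps_ext_formal_auto:
  fixes \<Omega> :: "real ^ 'm \<Rightarrow> real ^ 'm \<Rightarrow> real"
  assumes K: "formal_auto \<Omega> K k" and F: "F \<in> formal Cinf"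
  shows "fps_ext (\<lambda>f. K (fps_const f)) F = K F"
proof (rule Formal_Power_Series.fps_ext)
  fix n
  have add: "\<And>F G. F \<in> formal Cinf \<Longrightarrow> G \<in> formal Cinf \<Longrightarrow> K (F + G) = K F + K G"
    and mult: "\<And>F G. F \<in> formal Cinf \<Longrightarrow> G \<in> formal Cinf \<Longrightarrow> K (F * G) = K F * K G"
    and X: "K fps_X = fps_X" and const: "\<And>c. K (fps_const (\<lambda>_. c)) = fps_const (\<lambda>_. c)"
    using K by (auto simp: formal_auto_def)
  note sub = subspace_formal[OF subspace_Cinf]
  have K0: "K 0 = 0" using const[of 0] by (simp add: zero_fun_def[symmetric])
  have K1: "K 1 = 1" using const[of 1] by (simp add: one_fun_def[symmetric])
  have Fc: "fps_const (F $ i) \<in> formal Cinf" for i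
    by (intro fps_const_formal formal_nth[OF F] const_Cinf)
  have Xi: "(fps_X :: 'm fn fps) ^ i \<in> formal Cinf \<and> K (fps_X ^ i) = fps_X ^ i" for i
  proof (induction i)
    case 0
    have "(1 :: 'm fn fps) = fps_const 1" by simp
    then have "(1 :: 'm fn fps) \<in> formal Cinf" by (metis fps_const_formal const_Cinf(2,3))
    then show ?case by (simp add: K1)
  next
    case (Suc i)
    then show ?case by (simp add: times_formal fps_X_formal mult X)
  qed
  let ?T = "\<lambda>N. \<Sum>i\<le>N. fps_X ^ i * fps_const (F $ i)"
  have mem: "(fps_X :: 'm fn fps) ^ i * fps_const (F $ i) \<in> formal Cinf" for i
    using Xi Fc by (blast intro: times_formal)
  have T: "?T N \<in> formal Cinf" for N
    by (intro subspace_sum[OF sub] mem)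
  have KT: "K (?T N) = (\<Sum>i\<le>N. fps_X ^ i * K (fps_const (F $ i)))" for N
  proof (induction N)
    case 0
    then show ?case using mult[OF _ Fc, of 1 0] Xi[of 0] by simp
  next
    case (Suc N)
    then show ?case
      using add[OF T mem] mult[OF _ Fc] Xi by (simp del: power_Suc)
  qed
  have "?T n $ i = F $ i" if "i \<le> n" for i
  proof -
    have "?T n $ i = (\<Sum>j\<le>n. if j = i then F $ i else 0)"
      unfolding fps_sum_nth by (intro sum.cong refl) (auto simp: fps_X_power_mult_nth)
    then show ?thesis using that by simp
  qed
  then have "vanishes (Suc n) (F - ?T n)"
    by (auto simp: vanishes_def)
  then have "K (F - ?T n) $ n = 0"
    using formal_auto_vanishes[OF K] F T sub by (blast intro: subspace_diff)
  then have "K F $ n = K (?T n) $ n"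
    using add[OF subspace_diff[OF sub F T] T, of n n] by simp
  also have "\<dots> = (\<Sum>i\<le>n. K (fps_const (F $ i)) $ (n - i))"
    by (simp add: KT fps_sum_nth fps_X_power_mult_nth)
  finally show "fps_ext (\<lambda>f. K (fps_const f)) F $ n = K F $ n"
    by (simp add: fps_ext_def)
qed

text \<open>Restriction to constant series keeps the homomorphism properties, and the zeroth
  coefficient is the identity of \<open>Cinf\<close> because \<open>K\<close> preserves leading
  coefficients.\<close>

lemma formal_symplectomorphism_formal_auto:
  fixes \<Omega> :: "real ^ 'm \<Rightarrow> real ^ 'm \<Rightarrow> real"
  assumes \<Omega>: "symplectic_form \<Omega>" and K: "formal_auto \<Omega> K k"
  shows "formal_symplectomorphism \<Omega> (\<lambda>f. K (fps_const f))"
proof -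
  have c: "f \<in> Cinf \<Longrightarrow> fps_const f \<in> formal Cinf" for f :: "'m fn"
    by (intro fps_const_formal const_Cinf)
  have hom: "K (F + G) = K F + K G" "K (F * G) = K F * K G"
      "K (fps_bilin (poisson \<Omega>) F G) = fps_bilin (poisson \<Omega>) (K F) (K G)"
    if "F \<in> formal Cinf" "G \<in> formal Cinf" for F G
    using K that unfolding formal_auto_def by blast+
  have p: "fps_bilin (poisson \<Omega>) (fps_const f) (fps_const g) = fps_const (poisson \<Omega> f g)"
    if "f \<in> Cinf" "g \<in> Cinf" for f g
  proof (rule Formal_Power_Series.fps_ext)
    fix n
    have "fps_bilin (poisson \<Omega>) (fps_const f) (fps_const g) $ n
        = (\<Sum>i\<in>{..n}. if i = 0 \<and> n = 0 then poisson \<Omega> f g else 0)"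
      unfolding fps_bilin_nth
      using that bilin_on_zero_left[OF bilin_poisson[OF \<Omega>]] bilin_on_zero_right[OF bilin_poisson[OF \<Omega>]]
      by (intro sum.cong) (auto simp: const_Cinf)
    then show "fps_bilin (poisson \<Omega>) (fps_const f) (fps_const g) $ n = fps_const (poisson \<Omega> f g) $ n"
      by simp
  qed
  have "K (fps_const (\<lambda>x. r * f x)) = fps_const (\<lambda>_. r) * K (fps_const f)" if "f \<in> Cinf" for r f
  proof -
    have "K (fps_const (\<lambda>x. r * f x)) = K (fps_const (\<lambda>_. r) * fps_const f)"
      by (simp add: times_fun_def)
    also have "\<dots> = K (fps_const (\<lambda>_. r)) * K (fps_const f)"
      using K c[OF that] c[OF const_Cinf(1)] unfolding formal_auto_def by blast
    also have "K (fps_const (\<lambda>_. r)) = fps_const (\<lambda>_. r)"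
      using K unfolding formal_auto_def by blast
    finally show ?thesis .
  qed
  moreover have "bij_betw (\<lambda>f. K (fps_const f) $ 0) Cinf Cinf"
  proof -
    have "\<forall>F\<in>formal Cinf. vanishes 0 F \<longrightarrow> K F $ 0 = F $ 0"
      using K unfolding formal_auto_def by blast
    then have e: "K (fps_const f) $ 0 = f" if "f \<in> Cinf" for f
      using c[OF that] by simp
    show ?thesis
      by (rule bij_betw_byWitness[of _ "\<lambda>f. f"]) (auto simp: e)
  qed
  moreover have "K (fps_const 1) = 1"
  proof -
    have "\<forall>c. K (fps_const (\<lambda>_. c)) = fps_const (\<lambda>_. c)"
      using K unfolding formal_auto_def by blast
    from spec[OF this, of 1] show ?thesis by (simp add: one_fun_def[symmetric])
  qed
  ultimately show ?thesis
    using hom c formal_auto_closed[OF K]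
    by (simp add: formal_symplectomorphism_def p[symmetric]
        fps_const_add[symmetric] fps_const_mult[symmetric] del: fps_const_add fps_const_mult)
qed

text \<open>The intertwining clause of \<open>formal_auto\<close>, evaluated at the preimage of
  \<open>F\<close>, is the property that defines the push-forward. \<open>P\<close> is only asked to
  agree with \<open>K\<close> on the carrier, as is the case for the extension
  \<open>fps_ext\<close> of a restriction.\<close>

lemma push_vf_eq:
  assumes K: "formal_auto \<Omega> K k" and eq: "\<And>F. F \<in> formal Cinf \<Longrightarrow> P F = K F"
    and X: "X \<in> formal VF"
  shows "push_vf P X = k X"
proof -
  have b: "bij_betw K (formal Cinf) (formal Cinf)" using K by (simp add: formal_auto_def)
  have bP: "bij_betw P (formal Cinf) (formal Cinf)"
    using b eq by (simp cong: bij_betw_cong)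
  have ex: "fps_bilin vf_apply (k X) F = P (fps_bilin vf_apply X (inv_into (formal Cinf) P F))"
    if F: "F \<in> formal Cinf" for F
  proof -
    let ?G = "inv_into (formal Cinf) P F"
    have G: "?G \<in> formal Cinf" "P ?G = F"
      using bP F by (auto simp: bij_betw_def inv_into_into f_inv_into_f)
    have "K (fps_bilin vf_apply X ?G) = fps_bilin vf_apply (k X) (K ?G)"
      using K X G(1) by (simp add: formal_auto_def)
    then show ?thesis using G X by (simp add: eq vf_formal)
  qed
  show ?thesis
    unfolding push_vf_def
  proof (rule the_equality)
    show "k X \<in> formal VF \<and> (\<forall>F\<in>formal Cinf. fps_bilin vf_apply (k X) F =
        P (fps_bilin vf_apply X (inv_into (formal Cinf) P F)))"
      using formal_auto_closed(2)[OF K X] ex by simp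
  next
    fix Y
    assume "Y \<in> formal VF \<and> (\<forall>F\<in>formal Cinf. fps_bilin vf_apply Y F =
        P (fps_bilin vf_apply X (inv_into (formal Cinf) P F)))"
    then show "Y = k X" using ex by (intro formal_vf_eqI) simp
  qed
qed

lemma push_conn_eq:
  assumes \<Omega>: "symplectic_form \<Omega>" and K: "formal_auto \<Omega> K k"
    and X: "X \<in> formal VF" and Y: "Y \<in> formal VF"
    and D: "\<And>X Y. X \<in> formal VF \<Longrightarrow> Y \<in> formal VF \<Longrightarrow> cov D X Y \<in> formal VF"
  shows "push_conn (fps_ext (\<lambda>f. K (fps_const f))) D X Y =
    k (cov D (inv_into (formal VF) k X) (inv_into (formal VF) k Y))"
proof -
  let ?P = "fps_ext (\<lambda>f. K (fps_const f))"
  note inv = formal_auto_inv[OF \<Omega> K]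
  have b: "bij_betw K (formal Cinf) (formal Cinf)" using K by (simp add: formal_auto_def)
  have eq: "?P F = K F" if "F \<in> formal Cinf" for F
    using fps_ext_formal_auto[OF K that] .
  have inv_eq: "inv_into (formal Cinf) ?P F = inv_into (formal Cinf) K F" if F: "F \<in> formal Cinf" for F
  proof (rule inv_into_f_eq)
    show "inj_on ?P (formal Cinf)"
      using b eq by (simp add: bij_betw_def cong: inj_on_cong)
    show G: "inv_into (formal Cinf) K F \<in> formal Cinf"
      by (rule formal_auto_closed(1)[OF inv F])
    show "?P (inv_into (formal Cinf) K F) = F"
      using b F by (simp add: eq[OF G] bij_betw_inv_into_right)
  qed
  have Q: "push_vf (inv_into (formal Cinf) ?P) X = inv_into (formal VF) k X"
    if "X \<in> formal VF" for X
    by (rule push_vf_eq[OF inv inv_eq that])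
  show ?thesis
    unfolding push_conn_def Let_def Q[OF X] Q[OF Y]
    by (intro push_vf_eq[OF K eq] D formal_auto_closed(2)[OF inv] X Y)
qed

section \<open>Straightening a flat translation invariant curve\<close>

lemma cov_nth: "cov A X Y $ k = (\<Sum>a\<le>k. \<Sum>j\<le>k - a. (A $ a) (X $ j) (Y $ (k - a - j)))"
  by (simp add: cov_def fps_bilin_nth)

lemma graded_cov:
  assumes A: "\<And>k. bilin_on VF VF VF (A $ k)"
  shows "graded_bilin (formal VF) (formal VF) (formal VF) (cov A)"
proof -
  have b: "bilin_on (formal VF) (formal VF) (formal VF) (fps_bilin (A $ k))"
    and o: "\<And>F G n m. F \<in> formal VF \<Longrightarrow> G \<in> formal VF \<Longrightarrow> vanishes n F \<Longrightarrow> vanishes m G \<Longrightarrow>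
      vanishes (n + m) (fps_bilin (A $ k) F G)" for k
    using fps_bilin_graded[OF A] unfolding graded_bilin_def by blast+
  have "bilin_on (formal VF) (formal VF) (formal VF) (cov A)"
    unfolding bilin_on_def
    using subspace_formal[OF subspace_VF]
    by (auto simp: cov_def fps_eq_iff bilin_on_add_left[OF b] bilin_on_add_right[OF b]
        bilin_on_scale_left[OF b] bilin_on_scale_right[OF b] sum.distrib scaleR_right.sum
        intro!: formalI subspace_sum[OF subspace_VF] formal_nth[OF bilin_on_closed[OF b]])
  moreover have "vanishes (n + m) (cov A F G)"
    if "F \<in> formal VF" "G \<in> formal VF" "vanishes n F" "vanishes m G" for F G n m
    using o[OF that] by (auto simp: vanishes_def cov_def intro!: sum.neutral)
  ultimately show ?thesis by (simp add: graded_bilin_def)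
qed

definition const_tensor :: "(nat \<Rightarrow> real ^ 'm \<Rightarrow> real ^ 'm \<Rightarrow> real ^ 'm) \<Rightarrow> 'm conn fps" where
  "const_tensor a = Abs_fps (\<lambda>k X Y x. a k (X x) (Y x))"

lemma const_tensor_nth: "(const_tensor a $ k) X Y = (\<lambda>x. a k (X x) (Y x))"
  by (simp add: const_tensor_def)

lemma bilin_const_tensor:
  assumes "\<And>k. bilinear (a k)"
  shows "bilin_on VF VF VF (const_tensor a $ k)"
  unfolding bilin_on_def const_tensor_nth
  using assms[of k]
  by (auto simp: subspace_VF[unfolded VF_def] VF_def smooth_bilinear fun_eq_iff bilinear_ladd
      bilinear_radd bilinear_lmul bilinear_rmul)

text \<open>Commutativity of the products \<open>a k\<close> encodes that the connection is torsion-free, and \<open>flat\<close>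
  together with commutativity makes the formal product \<open>\<Sum>k. t\<^sup>k a k\<close> associative.\<close>

locale flat_symplectic_algebra =
  fixes \<Omega> :: "real ^ 'm \<Rightarrow> real ^ 'm \<Rightarrow> real"
    and a :: "nat \<Rightarrow> real ^ 'm \<Rightarrow> real ^ 'm \<Rightarrow> real ^ 'm"
  assumes \<Omega>: "symplectic_form \<Omega>"
    and bil: "\<And>k. bilinear (a k)"
    and zero: "\<And>u v. a 0 u v = 0"
    and comm: "\<And>k u v. a k u v = a k v u"
    and sp: "\<And>k u v w. \<Omega> (a k u v) w = \<Omega> (a k u w) v"
    and flat: "\<And>k u v w. (\<Sum>i\<le>k. a i u (a (k - i) v w)) = (\<Sum>i\<le>k. a i v (a (k - i) u w))"
begin

lemma \<Omega>_sum_left: "\<Omega> (\<Sum>i\<in>I. f i) w = (\<Sum>i\<in>I. \<Omega> (f i) w)"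
proof -
  have "linear (\<lambda>v. \<Omega> v w)"
    using symplectic_bilinear[OF \<Omega>] by (simp add: bilinear_def)
  then show ?thesis by (rule linear_sum)
qed

text \<open>The form \<open>T\<close> below is symmetric in its first three arguments and skew in the last two,
  hence zero.\<close>

lemma triple_product_zero: "(\<Sum>i\<le>k. a i u (a (k - i) v w)) = 0"
proof -
  define T where "T u v w z = \<Omega> (\<Sum>i\<le>k. a i u (a (k - i) v w)) z" for u v w z
  have sym12: "T u v w z = T v u w z" for u v w z
    unfolding T_def by (subst flat) (rule refl)
  have sym23: "T u v w z = T u w v z" for u v w z
    unfolding T_def by (subst (2) comm) (rule refl)
  \<comment> \<open>Left multiplications are infinitesimally symplectic: moving both across
    \<open>\<Omega>\<close> reverses their order at no cost in sign, and the skewness of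
    \<open>\<Omega>\<close> gives the minus. Reindexing by \<open>k - i\<close> and commutation
    restore the order.\<close>
  have skew: "T u v w z = - T u v z w" for u v w z
  proof -
    have "T u v w z = (\<Sum>i\<le>k. \<Omega> (a i u z) (a (k - i) v w))"
      by (simp add: T_def \<Omega>_sum_left sp[of _ u _ z])
    also have "\<dots> = (\<Sum>i\<le>k. - \<Omega> (a (k - i) v (a i u z)) w)"
      by (intro sum.cong refl) (metis sp symplectic_skew[OF \<Omega>])
    also have "\<dots> = (\<Sum>i\<le>k. - \<Omega> (a i v (a (k - i) u z)) w)"
      by (rule sum.reindex_bij_witness[of _ "\<lambda>i. k - i" "\<lambda>i. k - i"]) auto
    also have "\<dots> = - T v u z w"
      by (simp add: T_def \<Omega>_sum_left sum_negf)
    finally show ?thesis using sym12 by metis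
  qed
  \<comment> \<open>Transposing places 3, 4 and then 2, 3, three times over, is the identity
    permutation, but it changes the sign three times.\<close>
  have "T u v w z = 0" for z
  proof -
    have "T u v w z = - T u v z w" by (rule skew)
    also have "\<dots> = - T u z v w" using sym23[of u v z w] by simp
    also have "\<dots> = T u z w v" using skew[of u z v w] by simp
    also have "\<dots> = T u w z v" by (rule sym23)
    also have "\<dots> = - T u w v z" by (rule skew)
    also have "\<dots> = - T u v w z" using sym23[of u v w z] by simp
    finally show ?thesis by simp
  qed
  then show ?thesis
    using symplectic_nondegenerate[OF \<Omega>, of _ 0] bilinear_lzero[OF symplectic_bilinear[OF \<Omega>]]
    by (simp add: T_def)
qed

text \<open>The vector field whose formal flow straightens the connection; it is Hamiltonian, with a
  cubic Hamiltonian.\<close>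

definition E :: "'m vfield fps" where
  "E = Abs_fps (\<lambda>k x. (1 / 2) *\<^sub>R a k x x)"

lemma E_formal: "E \<in> formal VF"
  by (rule formalI) (simp add: E_def VF_def smooth_scaleR smooth_bilinear[OF bil])

lemma E_0: "E $ 0 = 0"
  by (simp add: E_def zero fun_eq_iff)

text \<open>By commutativity the two terms of the product rule coincide, and the factor 1/2 in
  \<open>E\<close> absorbs the doubling.\<close>

lemma fd_E: "fd (E $ k) x v = a k x v"
proof -
  have "fd (E $ k) x v = (1 / 2) *\<^sub>R (a k x v + a k v x)"
    by (simp add: E_def fd_scaleR_const smooth_bilinear[OF bil] fd_bilinear[OF bil]
        fdI[OF has_derivative_ident])
  then show ?thesis
    by (simp add: comm[of k v] scaleR_2[symmetric])
qed

abbreviation "C \<equiv> cov (const_tensor a)"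

abbreviation "\<L> \<equiv> fps_bilin lie_bracket E"

lemma C_graded: "graded_bilin (formal VF) (formal VF) (formal VF) C"
  by (intro graded_cov bilin_const_tensor bil)

lemma \<L>_raising: "raising (formal VF) \<L>"
  by (rule raising_fps_bilin[OF bilin_lie_bracket E_formal E_0])

text \<open>The defect is the second derivative of \<open>E\<close>. The first derivative at
  \<open>x\<close> is multiplication by \<open>x\<close>, linear in \<open>x\<close>, so the second
  is the constant tensor \<open>a\<close>.\<close>

lemma \<L>_trivial_connection:
  assumes "X \<in> formal VF" "Y \<in> formal VF"
  shows "\<L> (fps_bilin trivial_connection X Y) =
    fps_bilin trivial_connection (\<L> X) Y + fps_bilin trivial_connection X (\<L> Y) + C X Y"
proof -
  define H where "H e X Y = (\<lambda>x. fd (\<lambda>y. fd e y (Y x)) x (X x))" for e X Y :: "'m vfield"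
  have "fd (\<lambda>y. a i y v) x u = a i u v" for i u v x
    using fd_bilinear[OF bil smooth_ident smooth_const]
    by (simp add: fdI[OF has_derivative_ident] bilinear_rzero[OF bil])
  then have C: "fps_trilin H E X Y = C X Y"
    by (simp add: H_def fps_trilin_def cov_def fd_E fps_bilin_nth const_tensor_nth)
  have "\<L> (fps_bilin trivial_connection X Y) =
    fps_bilin trivial_connection (\<L> X) Y + fps_bilin trivial_connection X (\<L> Y) + fps_trilin H E X Y"
  proof (rule fps_bilin_leibniz[OF bilin_lie_bracket bilin_trivial_connection bilin_lie_bracket
        bilin_lie_bracket E_formal assms])
    fix i and x y :: "'m vfield"
    assume "x \<in> VF" "y \<in> VF"
    then show "lie_bracket (E $ i) (trivial_connection x y) = trivial_connection (lie_bracket (E $ i) x) y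
      + trivial_connection x (lie_bracket (E $ i) y) + H (E $ i) x y"
      unfolding H_def by (rule lie_bracket_trivial_connection[OF formal_nth[OF E_formal]])
  qed
  then show ?thesis by (simp only: C)
qed

text \<open>Regrouping by the sum of the first two indices isolates complete convolutions; for two
  factors taken from \<open>a\<close> these are triple products.\<close>

lemma sum4_zero:
  fixes g :: "nat \<Rightarrow> nat \<Rightarrow> nat \<Rightarrow> nat \<Rightarrow> 'b::comm_monoid_add"
  assumes "\<And>c j l. (\<Sum>i\<le>c. g i (c - i) j l) = 0"
  shows "(\<Sum>i\<le>k. \<Sum>b\<le>k - i. \<Sum>j\<le>k - i - b. g i b j (k - i - b - j)) = 0"
proof -
  have "(\<Sum>i\<le>k. \<Sum>b\<le>k - i. \<Sum>j\<le>k - i - b. g i b j (k - i - b - j))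
      = (\<Sum>m\<le>k. \<Sum>i\<le>m. \<Sum>j\<le>k - m. g i (m - i) j (k - m - j))"
    by (rule sum_reindex_add[symmetric])
  also have "\<dots> = (\<Sum>m\<le>k. \<Sum>j\<le>k - m. \<Sum>i\<le>m. g i (m - i) j (k - m - j))"
    by (intro sum.cong refl sum.swap)
  finally show ?thesis by (simp add: assms)
qed

lemma \<L>_C:
  assumes X: "X \<in> formal VF" and Y: "Y \<in> formal VF"
  shows "\<L> (C X Y) = C (\<L> X) Y + C X (\<L> Y)"
proof (rule Formal_Power_Series.fps_ext, rule ext)
  fix k x
  let ?A = "\<lambda>k. const_tensor a $ k"
  note b = bilin_const_tensor[OF bil]
  note lie = bilin_lie_bracket
  note mem = formal_nth[OF E_formal] formal_nth[OF X] formal_nth[OF Y]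
  define S where "S f = (\<Sum>i\<le>k. \<Sum>b\<le>k - i. \<Sum>j\<le>k - i - b. f i b j (k - i - b - j))"
    for f :: "nat \<Rightarrow> nat \<Rightarrow> nat \<Rightarrow> nat \<Rightarrow> real ^ 'm"
  have "(\<L> (C X Y) $ k) x = S (\<lambda>i b j l. lie_bracket (E $ i) (?A b (X $ j) (Y $ l)) x)"
    by (simp add: S_def fps_bilin_nth cov_nth sum_fun_apply bilin_on_sum_right[OF lie] mem
        bilin_on_closed[OF b] subspace_sum[OF subspace_VF])
  \<comment> \<open>In the product rule the derivatives of \<open>X\<close> and \<open>Y\<close> are
    completed to brackets with \<open>E\<close>. The corrections, together with the derivative of
    \<open>E\<close> along the product, are the three nested products below.\<close>
  also have "\<dots> = S (\<lambda>i b j l. ?A b (lie_bracket (E $ i) (X $ j)) (Y $ l) x)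
      + S (\<lambda>i b j l. ?A b (X $ j) (lie_bracket (E $ i) (Y $ l)) x)
      - S (\<lambda>i b j l. a i x (a b ((X $ j) x) ((Y $ l) x)))
      + S (\<lambda>i b j l. a b ((Y $ l) x) (a i x ((X $ j) x)))
      + S (\<lambda>i b j l. a b ((X $ j) x) (a i x ((Y $ l) x)))"
  proof -
    have sX: "smooth (X $ j)" and sY: "smooth (Y $ j)" for j
      using mem by (auto simp: VF_def)
    have "lie_bracket (E $ i) (?A b (X $ j) (Y $ l)) x =
      ?A b (lie_bracket (E $ i) (X $ j)) (Y $ l) x + ?A b (X $ j) (lie_bracket (E $ i) (Y $ l)) x
      - a i x (a b ((X $ j) x) ((Y $ l) x)) + a b ((Y $ l) x) (a i x ((X $ j) x))
      + a b ((X $ j) x) (a i x ((Y $ l) x))" for i b j l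
      by (simp add: lie_bracket_def const_tensor_nth fd_E fd_bilinear[OF bil sX sY]
          bilinear_lsub[OF bil] bilinear_rsub[OF bil] comm[of b "(Y $ l) x"])
    then show ?thesis by (simp add: S_def sum.distrib sum_subtractf)
  qed
  also have "S (\<lambda>i b j l. a i x (a b ((X $ j) x) ((Y $ l) x))) = 0"
    unfolding S_def by (rule sum4_zero) (rule triple_product_zero)
  also have "S (\<lambda>i b j l. a b ((Y $ l) x) (a i x ((X $ j) x))) = 0"
    unfolding S_def
  proof (rule sum4_zero)
    fix c j l
    have "(\<Sum>i\<le>c. a (c - i) ((Y $ l) x) (a i x ((X $ j) x)))
        = (\<Sum>i\<le>c. a i ((Y $ l) x) (a (c - i) x ((X $ j) x)))"
      by (rule sum.reindex_bij_witness[of _ "\<lambda>i. c - i" "\<lambda>i. c - i"]) auto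
    then show "(\<Sum>i\<le>c. a (c - i) ((Y $ l) x) (a i x ((X $ j) x))) = 0"
      by (simp add: triple_product_zero)
  qed
  also have "S (\<lambda>i b j l. a b ((X $ j) x) (a i x ((Y $ l) x))) = 0"
    unfolding S_def
  proof (rule sum4_zero)
    fix c j l
    have "(\<Sum>i\<le>c. a (c - i) ((X $ j) x) (a i x ((Y $ l) x)))
        = (\<Sum>i\<le>c. a i ((X $ j) x) (a (c - i) x ((Y $ l) x)))"
      by (rule sum.reindex_bij_witness[of _ "\<lambda>i. c - i" "\<lambda>i. c - i"]) auto
    then show "(\<Sum>i\<le>c. a (c - i) ((X $ j) x) (a i x ((Y $ l) x))) = 0"
      by (simp add: triple_product_zero)
  qed
  also have "S (\<lambda>i b j l. ?A b (lie_bracket (E $ i) (X $ j)) (Y $ l) x) = (C (\<L> X) Y $ k) x"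
  proof -
    have "(C (\<L> X) Y $ k) x = (\<Sum>b\<le>k. \<Sum>m\<le>k - b. \<Sum>i\<le>m.
        ?A b (lie_bracket (E $ i) (X $ (m - i))) (Y $ (k - b - m)) x)"
      by (simp add: fps_bilin_nth cov_nth sum_fun_apply bilin_on_sum_left[OF b] mem
          bilin_on_closed[OF lie])
    also have "\<dots> = (\<Sum>b\<le>k. \<Sum>i\<le>k - b. \<Sum>j\<le>k - b - i.
        ?A b (lie_bracket (E $ i) (X $ j)) (Y $ (k - b - i - j)) x)"
      by (intro sum.cong refl sum_reindex_add)
    also have "\<dots> = S (\<lambda>i b j l. ?A b (lie_bracket (E $ i) (X $ j)) (Y $ l) x)"
      unfolding S_def by (rule sum_reindex_swap)
    finally show ?thesis by simp
  qed
  also have "S (\<lambda>i b j l. ?A b (X $ j) (lie_bracket (E $ i) (Y $ l)) x) = (C X (\<L> Y) $ k) x"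
  proof -
    have "(C X (\<L> Y) $ k) x = (\<Sum>b\<le>k. \<Sum>j\<le>k - b. \<Sum>i\<le>k - b - j.
        ?A b (X $ j) (lie_bracket (E $ i) (Y $ (k - b - j - i))) x)"
      by (simp add: fps_bilin_nth cov_nth sum_fun_apply bilin_on_sum_right[OF b] mem
          bilin_on_closed[OF lie])
    also have "\<dots> = (\<Sum>b\<le>k. \<Sum>i\<le>k - b. \<Sum>j\<le>k - b - i.
        ?A b (X $ j) (lie_bracket (E $ i) (Y $ (k - b - i - j))) x)"
      by (intro sum.cong refl sum_reindex_swap)
    also have "\<dots> = S (\<lambda>i b j l. ?A b (X $ j) (lie_bracket (E $ i) (Y $ l)) x)"
      unfolding S_def by (rule sum_reindex_swap)
    finally show ?thesis by simp
  qed
  finally show "(\<L> (C X Y) $ k) x = ((C (\<L> X) Y + C X (\<L> Y)) $ k) x"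
    by simp
qed

lemma straightening:
  obtains P p where "formal_auto \<Omega> P p"
    and "\<And>X Y. X \<in> formal VF \<Longrightarrow> Y \<in> formal VF \<Longrightarrow>
      p (fps_bilin trivial_connection X Y) =
      fps_bilin trivial_connection (p X) (p Y) + cov (const_tensor a) (p X) (p Y)"
proof
  show "formal_auto \<Omega> (fexp (fps_bilin vf_apply E)) (fexp \<L>)"
  proof (rule formal_auto_fexp[OF \<Omega> E_formal E_0])
    show "\<Omega> (fd (E $ k) x v) w = - \<Omega> v (fd (E $ k) x w)" for k x v w
      unfolding fd_E by (metis sp symplectic_skew[OF \<Omega>])
  qed
  show "fexp \<L> (fps_bilin trivial_connection X Y) =
      fps_bilin trivial_connection (fexp \<L> X) (fexp \<L> Y) + C (fexp \<L> X) (fexp \<L> Y)"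
    if "X \<in> formal VF" "Y \<in> formal VF" for X Y
    \<comment> \<open>The trivial connection has the defect \<open>C\<close> under
      \<open>\<L>\<close>, and \<open>C\<close> itself has none.\<close>
    by (rule fexp_leibniz[OF \<L>_raising \<L>_raising \<L>_raising
          fps_bilin_graded[OF bilin_trivial_connection] C_graded that(1) _ that(2)])
      (use that in \<open>simp_all add: \<L>_trivial_connection \<L>_C fexp_closed[OF \<L>_raising subspace_VF]\<close>)
qed

end

section \<open>From a flat invariant connection to its algebra\<close>

lemma bilin_tensor21:
  assumes "tensor21 A"
  shows "bilin_on VF VF VF (A :: 'a::finite conn)"
proof -
  \<comment> \<open>Constants are smooth functions, so linearity over \<open>Cinf\<close> contains
    homogeneity over the reals.\<close>
  have scale: "c *\<^sub>R X = fn_scale (\<lambda>_. c) X" for c and X :: "'a vfield"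
    by (simp add: fn_scale_def scaleR_fun_def)
  have "A (c *\<^sub>R X) Y = c *\<^sub>R A X Y" "A X (c *\<^sub>R Y) = c *\<^sub>R A X Y"
    if "X \<in> VF" "Y \<in> VF" for c X Y
    using assms that const_Cinf(1) unfolding tensor21_def scale by blast+
  then show ?thesis
    using assms subspace_VF unfolding bilin_on_def tensor21_def by blast
qed

lemma const_VF [simp]: "(\<lambda>_. u) \<in> VF"
  by (simp add: VF_def)

text \<open>Expand both fields in constant basis fields and pull out the coefficient functions. What
  remains is \<open>A\<close> on constant fields, whose values translation invariance makes
  independent of the point.\<close>

lemma tensor21_pointwise:
  fixes A :: "'m::finite conn"
  assumes A: "tensor21 A" and inv: "translation_invariant_op A" and X: "X \<in> VF" and Y: "Y \<in> VF"
  shows "A X Y x = A (\<lambda>_. X x) (\<lambda>_. Y x) 0"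
proof -
  note b = bilin_tensor21[OF A]
  have const: "A (\<lambda>_. u) (\<lambda>_. v) x = A (\<lambda>_. u) (\<lambda>_. v) 0" for u v x
  proof -
    have "A (\<lambda>_. u) (\<lambda>_. v) = (\<lambda>y. A (\<lambda>_. u) (\<lambda>_. v) (y + x))"
      by (rule inv[unfolded translation_invariant_op_def, rule_format, OF const_VF const_VF])
    from fun_cong[OF this, of 0] show ?thesis by simp
  qed
  have exp: "X = (\<Sum>b\<in>Basis. fn_scale (\<lambda>x. X x \<bullet> b) (\<lambda>_. b))" for X :: "'m vfield"
    by (rule ext) (simp add: sum_fun_apply fn_scale_def euclidean_representation)
  have comp: "(\<lambda>x. X x \<bullet> b) \<in> Cinf" if "X \<in> VF" for X :: "'m vfield" and b
    using that smooth_bilinear[of "(\<bullet>)" X "\<lambda>_. b"]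
    by (simp add: VF_def Cinf_def bilinear_conv_bounded_bilinear bounded_bilinear_inner)
  have sc: "fn_scale f X \<in> VF" if "f \<in> Cinf" "X \<in> VF" for f and X :: "'m vfield"
    using that by (simp add: Cinf_def VF_def fn_scale_def smooth_scaleR)
  have A1: "A (fn_scale f X) Y = fn_scale f (A X Y)" and A2: "A X (fn_scale f Y) = fn_scale f (A X Y)"
    if "f \<in> Cinf" "X \<in> VF" "Y \<in> VF" for f X Y
    using A that by (auto simp: tensor21_def)
  have main: "A X Y x = (\<Sum>b\<in>Basis. \<Sum>c\<in>Basis. (X x \<bullet> b) *\<^sub>R (Y x \<bullet> c) *\<^sub>R A (\<lambda>_. b) (\<lambda>_. c) 0)"
    if X: "X \<in> VF" and Y: "Y \<in> VF" for X Y x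
  proof -
    have "A X Y = (\<Sum>b\<in>Basis. A (fn_scale (\<lambda>x. X x \<bullet> b) (\<lambda>_. b)) Y)"
      by (subst exp[of X], rule bilin_on_sum_left[OF b finite_Basis _ Y]) (intro sc comp X const_VF)
    also have "\<dots> = (\<Sum>b\<in>Basis. fn_scale (\<lambda>x. X x \<bullet> b) (A (\<lambda>_. b) Y))"
      by (intro sum.cong refl A1 comp X Y const_VF)
    also have "\<dots> = (\<Sum>b\<in>Basis. fn_scale (\<lambda>x. X x \<bullet> b)
        (\<Sum>c\<in>Basis. fn_scale (\<lambda>x. Y x \<bullet> c) (A (\<lambda>_. b) (\<lambda>_. c))))"
    proof (rule sum.cong[OF refl])
      fix b' :: "real ^ 'm"
      have "A (\<lambda>_. b') Y = (\<Sum>c\<in>Basis. A (\<lambda>_. b') (fn_scale (\<lambda>x. Y x \<bullet> c) (\<lambda>_. c)))"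
        by (subst exp[of Y], rule bilin_on_sum_right[OF b finite_Basis _ const_VF])
          (intro sc comp Y const_VF)
      also have "\<dots> = (\<Sum>c\<in>Basis. fn_scale (\<lambda>x. Y x \<bullet> c) (A (\<lambda>_. b') (\<lambda>_. c)))"
        by (intro sum.cong refl A2 comp Y const_VF)
      finally show "fn_scale (\<lambda>x. X x \<bullet> b') (A (\<lambda>_. b') Y) = fn_scale (\<lambda>x. X x \<bullet> b')
          (\<Sum>c\<in>Basis. fn_scale (\<lambda>x. Y x \<bullet> c) (A (\<lambda>_. b') (\<lambda>_. c)))" by simp
    qed
    finally show ?thesis
      by (simp add: sum_fun_apply fn_scale_def scaleR_right.sum const[of _ _ x])
  qed
  show ?thesis
    using main[OF X Y, of x] main[OF const_VF const_VF, of "X x" "Y x" 0] by simp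
qed

lemma flat_symplectic_algebra_exists:
  fixes \<Omega> :: "real ^ 'm \<Rightarrow> real ^ 'm \<Rightarrow> real"
    and D :: "'m conn fps"
  assumes \<Omega>: "symplectic_form \<Omega>" and D: "formal_symplectic_connection \<Omega> D"
    and inv: "translation_invariant D" and flat: "flat D"
    and D0: "\<forall>X\<in>VF. \<forall>Y\<in>VF. (D $ 0) X Y = trivial_connection X Y"
  obtains a where "flat_symplectic_algebra \<Omega> a"
    and "\<And>X Y. X \<in> formal VF \<Longrightarrow> Y \<in> formal VF \<Longrightarrow>
      cov D X Y = fps_bilin trivial_connection X Y + cov (const_tensor a) X Y"
proof -
  \<comment> \<open>The value 0 at \<open>k = 0\<close> splits off the trivial connection, which is
    not tensorial.\<close>
  define a where "a k u v = (if k = 0 then 0 else (D $ k) (\<lambda>_. u) (\<lambda>_. v) 0)" for k u v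
  have tens: "tensor21 (D $ k)" and sym: "totally_symmetric \<Omega> (D $ k)" if "k > 0" for k
    using D that by (auto simp: formal_symplectic_connection_def)
  have Dk: "(D $ k) X Y = (const_tensor a $ k) X Y" if "X \<in> VF" "Y \<in> VF" "k > 0" for k X Y
    using tensor21_pointwise[OF tens[OF that(3)] _ that(1,2)] inv that(3)
    by (auto simp: const_tensor_nth a_def translation_invariant_def)
  have zero: "a 0 u v = 0" for u v by (simp add: a_def)
  have bil: "bilinear (a k)" for k
  proof (cases "k = 0")
    case True
    then show ?thesis by (simp add: bilinear_def zero linear_zero)
  next
    case False
    then have b: "bilin_on VF VF VF (D $ k)" by (intro bilin_tensor21 tens) simp
    have add: "(\<lambda>_. u + v) = ((\<lambda>_. u) + (\<lambda>_. v) :: 'm vfield)" for u v by (simp add: plus_fun_def)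
    have scale: "(\<lambda>_. c *\<^sub>R u) = (c *\<^sub>R (\<lambda>_. u) :: 'm vfield)" for c u by (simp add: scaleR_fun_def)
    show ?thesis
      using False
      by (auto simp: bilinear_def a_def add scale bilin_on_add_left[OF b] bilin_on_add_right[OF b]
          bilin_on_scale_left[OF b] bilin_on_scale_right[OF b] intro!: linearI)
  qed
  have om: "\<Omega> 0 w = 0" for w by (rule bilinear_lzero[OF symplectic_bilinear[OF \<Omega>]])
  have sp': "\<Omega> (a k u v) w = \<Omega> (a k v u) w" "\<Omega> (a k u v) w = \<Omega> (a k u w) v" for k u v w
  proof -
    have "vf_pair \<Omega> ((D $ k) (\<lambda>_. u) (\<lambda>_. v)) (\<lambda>_. w) = vf_pair \<Omega> ((D $ k) (\<lambda>_. v) (\<lambda>_. u)) (\<lambda>_. w) \<and>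
        vf_pair \<Omega> ((D $ k) (\<lambda>_. u) (\<lambda>_. v)) (\<lambda>_. w) = vf_pair \<Omega> ((D $ k) (\<lambda>_. u) (\<lambda>_. w)) (\<lambda>_. v)"
      if "k > 0"
      using sym[OF that] const_VF unfolding totally_symmetric_def by blast
    then show "\<Omega> (a k u v) w = \<Omega> (a k v u) w" "\<Omega> (a k u v) w = \<Omega> (a k u w) v"
      by (auto simp: a_def om vf_pair_def dest!: fun_cong[of _ _ 0])
  qed
  have comm: "a k u v = a k v u" for k u v
    using symplectic_nondegenerate[OF \<Omega>] sp'(1) by blast
  have cov: "cov D X Y = fps_bilin trivial_connection X Y + cov (const_tensor a) X Y"
    if "X \<in> formal VF" "Y \<in> formal VF" for X Y
  proof (rule Formal_Power_Series.fps_ext)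
    fix k
    note mem = formal_nth[OF that(1)] formal_nth[OF that(2)]
    have "fps_bilin (D $ b) X Y $ (k - b) = (if b = 0 then fps_bilin trivial_connection X Y $ k else 0)
        + fps_bilin (const_tensor a $ b) X Y $ (k - b)" for b
    proof (cases "b = 0")
      case True
      then show ?thesis
        using mem D0 by (simp add: fps_bilin_nth const_tensor_nth zero flip: zero_fun_def)
    next
      case False
      then show ?thesis
        using mem by (simp add: fps_bilin_nth Dk)
    qed
    then have "cov D X Y $ k = (\<Sum>b\<le>k. if b = 0 then fps_bilin trivial_connection X Y $ k else 0)
        + cov (const_tensor a) X Y $ k"
      by (simp add: cov_def sum.distrib)
    then show "cov D X Y $ k = (fps_bilin trivial_connection X Y + cov (const_tensor a) X Y) $ k"
      by simp
  qed
  let ?V = "formal VF :: 'm vfield fps set"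
  let ?c = "\<lambda>u. fps_const (\<lambda>_::real ^ 'm. u :: real ^ 'm)"
  have zeroVF: "0 \<in> VF" using subspace_VF by (rule subspace_0)
  have c: "?c u \<in> formal VF" for u
    by (intro fps_const_formal const_VF zeroVF)
  \<comment> \<open>Stated for every series \<open>Z\<close> of constant fields, since a covariant
    derivative of constant fields is again such a series and has to be differentiated once
    more.\<close>
  have cov_const: "cov D (?c u) Z $ k = (\<lambda>_. \<Sum>i\<le>k. a i u (z (k - i)))"
    if Z: "\<And>k. Z $ k = (\<lambda>_. z k)" for u Z z k
  proof -
    have "Z \<in> formal VF" by (rule formalI) (simp add: Z)
    moreover have "fps_bilin trivial_connection (?c u) Z = 0"
      by (simp add: fps_eq_iff fps_bilin_nth Z trivial_connection_def flip: zero_fun_def)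
    moreover have "cov (const_tensor a) (?c u) Z $ k = (\<lambda>_. \<Sum>i\<le>k. a i u (z (k - i)))"
    proof
      fix x
      have "(\<Sum>j\<le>k - i. (const_tensor a $ i) (?c u $ j) (Z $ (k - i - j)) x)
          = (\<Sum>j\<in>{0}. (const_tensor a $ i) (?c u $ j) (Z $ (k - i - j)) x)" for i
        by (intro sum.mono_neutral_right) (auto simp: const_tensor_nth bilinear_lzero[OF bil])
      then show "(cov (const_tensor a) (?c u) Z $ k) x = (\<Sum>i\<le>k. a i u (z (k - i)))"
        by (simp add: cov_nth sum_fun_apply const_tensor_nth Z)
    qed
    ultimately show ?thesis using cov[OF c] by simp
  qed
  have cov_const2: "cov D (?c u) (?c v) $ k = (\<lambda>_. a k u v)" for u v k
  proof -
    have "(\<Sum>i\<le>k. a i u (if k - i = 0 then v else 0)) = (\<Sum>i\<in>{k}. a i u (if k - i = 0 then v else 0))"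
      by (intro sum.mono_neutral_right) (auto simp: bilinear_rzero[OF bil])
    then show ?thesis
      using cov_const[of "?c v" "\<lambda>k. if k = 0 then v else 0" u k] by (auto simp: fun_eq_iff)
  qed
  have cov_const3: "cov D (?c u) (cov D (?c v) (?c w)) $ k = (\<lambda>_. \<Sum>i\<le>k. a i u (a (k - i) v w))"
    for u v w k
    by (rule cov_const) (rule cov_const2)
  have flat': "(\<Sum>i\<le>k. a i u (a (k - i) v w)) = (\<Sum>i\<le>k. a i v (a (k - i) u w))" for k u v w
  proof -
    have "fps_bilin lie_bracket (?c u) (?c v) = 0"
    proof (rule Formal_Power_Series.fps_ext)
      fix k
      have c_nth: "?c u $ i = (\<lambda>_. if i = 0 then u else 0)" for u i
        by auto
      show "fps_bilin lie_bracket (?c u) (?c v) $ k = 0 $ k"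
        unfolding fps_bilin_nth lie_bracket_def c_nth by (simp add: zero_fun_def[symmetric])
    qed
    \<comment> \<open>The Lie bracket term of the curvature; its vanishing follows from bilinearity
      of both parts of the decomposition of \<open>cov D\<close>.\<close>
    moreover have "cov D 0 (?c w) = 0"
    proof -
      have "0 \<in> ?V" by (rule subspace_0[OF subspace_formal[OF subspace_VF]])
      moreover have "bilin_on ?V ?V ?V (fps_bilin trivial_connection)"
        by (intro fps_bilin_bilin bilin_trivial_connection)
      moreover have "bilin_on ?V ?V ?V (cov (const_tensor a))"
        by (intro graded_bilin_bilin graded_cov bilin_const_tensor bil)
      ultimately show ?thesis
        using cov[OF _ c, of 0 w] by (simp add: bilin_on_zero_left[OF _ c])
    qed
    moreover have "curvature D (?c u) (?c v) (?c w) = 0"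
      using flat c unfolding flat_def by blast
    ultimately have "cov D (?c u) (cov D (?c v) (?c w)) = cov D (?c v) (cov D (?c u) (?c w))"
      by (simp add: curvature_def)
    then have "cov D (?c u) (cov D (?c v) (?c w)) $ k = cov D (?c v) (cov D (?c u) (?c w)) $ k"
      by simp
    then show ?thesis unfolding cov_const3 by (rule fun_cong)
  qed
  have "flat_symplectic_algebra \<Omega> a"
    by unfold_locales (fact \<Omega> bil zero comm sp'(2) flat')+
  from that[OF this cov] show ?thesis .
qed

theorem proposition1:
  fixes \<Omega> :: "real ^ 'm \<Rightarrow> real ^ 'm \<Rightarrow> real"
    and n :: nat
    and D D' :: "'m conn fps"
  assumes "CARD('m) = 2 * n"
    and "symplectic_form \<Omega>"
    and "formal_symplectic_connection \<Omega> D" and "formal_symplectic_connection \<Omega> D'"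
    and "translation_invariant D" and "translation_invariant D'"
    and "flat D" and "flat D'"
    and "ricci_type n \<Omega> D" and "ricci_type n \<Omega> D'"
    and "\<forall>X\<in>VF. \<forall>Y\<in>VF. (D $ 0) X Y = trivial_connection X Y"
    and "\<forall>X\<in>VF. \<forall>Y\<in>VF. (D' $ 0) X Y = trivial_connection X Y"
  shows "\<exists>\<psi>. formal_symplectomorphism \<Omega> \<psi> \<and>
    (\<forall>X\<in>formal VF. \<forall>Y\<in>formal VF. push_conn (fps_ext \<psi>) D X Y = cov D' X Y)"
proof -
  let ?V = "formal VF :: 'm vfield fps set" and ?triv = "fps_bilin trivial_connection"
  have straight: "\<exists>P p. formal_auto \<Omega> P p \<and> (\<forall>X\<in>?V. \<forall>Y\<in>?V. p (?triv X Y) = cov D (p X) (p Y)) \<and>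
      (\<forall>X\<in>?V. \<forall>Y\<in>?V. cov D X Y \<in> ?V)"
    if D: "formal_symplectic_connection \<Omega> D" "translation_invariant D" "flat D"
      "\<forall>X\<in>VF. \<forall>Y\<in>VF. (D $ 0) X Y = trivial_connection X Y" for D
  proof -
    obtain a where a: "flat_symplectic_algebra \<Omega> a"
      and cov: "\<And>X Y. X \<in> ?V \<Longrightarrow> Y \<in> ?V \<Longrightarrow> cov D X Y = ?triv X Y + cov (const_tensor a) X Y"
      using flat_symplectic_algebra_exists[OF assms(2) D] by blast
    interpret flat_symplectic_algebra \<Omega> a by (rule a)
    obtain P p where P: "formal_auto \<Omega> P p" and
      p: "\<And>X Y. X \<in> ?V \<Longrightarrow> Y \<in> ?V \<Longrightarrow> p (?triv X Y) = ?triv (p X) (p Y) + cov (const_tensor a) (p X) (p Y)"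
      by (rule straightening) blast
    have "?triv X Y \<in> ?V" "cov (const_tensor a) X Y \<in> ?V" if "X \<in> ?V" "Y \<in> ?V" for X Y
      using that
      by (rule bilin_on_closed[OF fps_bilin_bilin[OF bilin_trivial_connection]],
          rule bilin_on_closed[OF graded_bilin_bilin[OF C_graded]])
    then have "cov D X Y \<in> ?V" if "X \<in> ?V" "Y \<in> ?V" for X Y
      using that by (simp add: cov subspace_add[OF subspace_formal[OF subspace_VF]])
    then show ?thesis
      using P p cov formal_auto_closed(2)[OF P] by (intro exI[of _ P] exI[of _ p]) simp
  qed
  obtain P p where P: "formal_auto \<Omega> P p"
    and p: "\<And>X Y. X \<in> ?V \<Longrightarrow> Y \<in> ?V \<Longrightarrow> p (?triv X Y) = cov D (p X) (p Y)"
    and D: "\<And>X Y. X \<in> ?V \<Longrightarrow> Y \<in> ?V \<Longrightarrow> cov D X Y \<in> ?V"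
    using straight[OF assms(3,5,7,11)] by blast
  obtain P' p' where P': "formal_auto \<Omega> P' p'"
    and p': "\<And>X Y. X \<in> ?V \<Longrightarrow> Y \<in> ?V \<Longrightarrow> p' (?triv X Y) = cov D' (p' X) (p' Y)"
    using straight[OF assms(4,6,8,12)] by blast
  \<comment> \<open>From \<open>D\<close> back to the trivial connection, then on to
    \<open>D'\<close>.\<close>
  define K where "K = P' \<circ> inv_into (formal Cinf) P"
  define k where "k = p' \<circ> inv_into ?V p"
  have K: "formal_auto \<Omega> K k"
    unfolding K_def k_def by (rule formal_auto_comp[OF formal_auto_inv[OF assms(2) P] P'])
  have b: "bij_betw p ?V ?V" "bij_betw p' ?V ?V" "bij_betw k ?V ?V"
    using P P' K by (auto simp: formal_auto_def)
  have kp: "k (p U) = p' U" if "U \<in> ?V" for U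
    using that b(1) by (simp add: k_def bij_betw_inv_into_left)
  have "push_conn (fps_ext (\<lambda>f. K (fps_const f))) D X Y = cov D' X Y"
    if X: "X \<in> ?V" and Y: "Y \<in> ?V" for X Y
  proof -
    \<comment> \<open>Arguments written as \<open>p'\<close>-images let every inverse cancel through
      \<open>kp\<close>.\<close>
    have "X \<in> p' ` ?V" "Y \<in> p' ` ?V"
      using X Y bij_betw_imp_surj_on[OF b(2)] by simp_all
    then obtain U W where U: "U \<in> ?V" "p' U = X" and W: "W \<in> ?V" "p' W = Y"
      by blast
    have kinv: "inv_into ?V k (p' Z) = p Z" if "Z \<in> ?V" for Z
      using bij_betw_inv_into_left[OF b(3), of "p Z"] formal_auto_closed(2)[OF P that] kp[OF that]
      by simp
    have "push_conn (fps_ext (\<lambda>f. K (fps_const f))) D X Y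
        = k (cov D (inv_into ?V k X) (inv_into ?V k Y))"
      by (rule push_conn_eq[OF assms(2) K X Y D])
    also have "\<dots> = k (cov D (p U) (p W))"
      by (simp add: kinv[OF U(1), unfolded U(2)] kinv[OF W(1), unfolded W(2)])
    also have "\<dots> = k (p (?triv U W))"
      by (simp add: p U W)
    also have "\<dots> = p' (?triv U W)"
      by (intro kp bilin_on_closed[OF fps_bilin_bilin[OF bilin_trivial_connection]] U W)
    also have "\<dots> = cov D' X Y"
      by (simp add: p' U W)
    finally show ?thesis .
  qed
  then show ?thesis
    using formal_symplectomorphism_formal_auto[OF assms(2) K] by blast
qed

end
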